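(* Let $C$ and $D$ be coalgebras over a field $k$. The map $$F:(\mathsf{Tw},\circ)\to\big((C\otimes D)',\star\big),\qquad F(\Psi')=\phi_\Psi:=(\varepsilon_D\otimes\varepsilon_C)\circ\Psi'\circ\tau=(\varepsilon_D\otimes\varepsilon_C)\circ\Psi,$$ where $\Psi=\Psi'\circ\tau$ and $\tau: C\otimes D\to D\otimes C$ is the flip, is an algebra isomorphism.
   Context: All coalgebras are coassociative and counital over the field $k$, with Sweedler notation $\Delta(c)=c_{(1)}\otimes c_{(2)}$. $\mathsf{Tw}$ is the set of $k$-linear maps $\Psi': D\otimes C\to D\otimes C$ which are left $D$-colinear and right $C$-colinear, i.e. $(\Delta_D\otimes\mathrm{id}_C)\Psi'=(\mathrm{id}_D\otimes\Psi')(\Delta_D\otimes\mathrm{id}_C)$ and $(\mathrm{id}_D\otimes\Delta_C)\Psi'=(\Psi'\otimes\mathrm{id}_C)(\mathrm{id}_D\otimes\Delta_C)$; it is a unital algebra under composition. $(C\otimes D)'$ is the space of linear functionals $C\otimes D\to k$; the product $\star$ on it is $(\phi\star\phi')(c\otimes d)=\phi(c_{(2)}\otimes d_{(1)})\,\phi'(c_{(1)}\otimes d_{(2)})$, which is associative with unit $\varepsilon_C\otimes\varepsilon_D$. *)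

theory Defs
  imports "HOL-Algebra.QuotRing" "HOL-Algebra.Module"
begin

text \<open>
  Vector spaces over a field \<open>K\<close> are modules over \<open>K\<close> in the sense of \<^locale>\<open>module\<close>. The record
  type of modules extends that of rings, so where only a vector space is meant the fields
  \<^const>\<open>mult\<close> and \<^const>\<open>one\<close> are left \<^const>\<open>undefined\<close>. Maps out of a carrier that are
  collected in a set are \<^const>\<open>extensional\<close>, so that equality of maps is equality in HOL.
\<close>

definition is_linear ::
  "('k, 'r) ring_scheme \<Rightarrow> ('k, 'v, 'x) module_scheme \<Rightarrow> ('k, 'w, 'y) module_scheme
    \<Rightarrow> ('v \<Rightarrow> 'w) \<Rightarrow> bool"
  where "is_linear K V W f \<longleftrightarrow>
    f \<in> carrier V \<rightarrow> carrier W \<and>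
    (\<forall>x\<in>carrier V. \<forall>y\<in>carrier V. f (x \<oplus>\<^bsub>V\<^esub> y) = f x \<oplus>\<^bsub>W\<^esub> f y) \<and>
    (\<forall>a\<in>carrier K. \<forall>x\<in>carrier V. f (a \<odot>\<^bsub>V\<^esub> x) = a \<odot>\<^bsub>W\<^esub> f x)"

definition linear_maps ::
  "('k, 'r) ring_scheme \<Rightarrow> ('k, 'v, 'x) module_scheme \<Rightarrow> ('k, 'w, 'y) module_scheme
    \<Rightarrow> ('v \<Rightarrow> 'w) set"
  where "linear_maps K V W = {f \<in> extensional (carrier V). is_linear K V W f}"

definition scalars :: "('k, 'r) ring_scheme \<Rightarrow> ('k, 'k) module"
  where "scalars K = \<lparr>carrier = carrier K, mult = mult K, one = one K, zero = zero K, add = add K,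
    smult = mult K\<rparr>"


section \<open>Tensor products of vector spaces\<close>

definition free_space :: "('k, 'r) ring_scheme \<Rightarrow> 's set \<Rightarrow> ('k, 's \<Rightarrow> 'k) module"
  where "free_space K S = \<lparr>
    carrier = {x. range x \<subseteq> carrier K \<and> {s. x s \<noteq> \<zero>\<^bsub>K\<^esub>} \<subseteq> S \<and> finite {s. x s \<noteq> \<zero>\<^bsub>K\<^esub>}},
    mult = undefined, one = undefined,
    zero = (\<lambda>s. \<zero>\<^bsub>K\<^esub>), add = (\<lambda>x y s. x s \<oplus>\<^bsub>K\<^esub> y s), smult = (\<lambda>a x s. a \<otimes>\<^bsub>K\<^esub> x s)\<rparr>"

definition free_gen :: "('k, 'r) ring_scheme \<Rightarrow> 's \<Rightarrow> 's \<Rightarrow> 'k"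
  where "free_gen K s = (\<lambda>t. if t = s then \<one>\<^bsub>K\<^esub> else \<zero>\<^bsub>K\<^esub>)"

definition span_in :: "('k, 'r) ring_scheme \<Rightarrow> ('k, 'v, 'x) module_scheme \<Rightarrow> 'v set \<Rightarrow> 'v set"
  where "span_in K V A = \<Inter>{N. submodule N K V \<and> A \<subseteq> N}"

definition quotient_space :: "('k, 'v, 'x) module_scheme \<Rightarrow> 'v set \<Rightarrow> ('k, 'v set) module"
  where "quotient_space V N = \<lparr>carrier = a_rcosets\<^bsub>V\<^esub> N, mult = undefined, one = undefined,
    zero = N, add = set_add V, smult = (\<lambda>a X. \<Union>x\<in>X. N +>\<^bsub>V\<^esub> (a \<odot>\<^bsub>V\<^esub> x))\<rparr>"

definition tensor_relations ::
  "('k, 'r) ring_scheme \<Rightarrow> ('k, 'v, 'x) module_scheme \<Rightarrow> ('k, 'w, 'y) module_scheme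
    \<Rightarrow> ('v \<times> 'w \<Rightarrow> 'k) set"
  where "tensor_relations K V W =
    (let P = free_space K (carrier V \<times> carrier W); e = (\<lambda>v w. free_gen K (v, w)) in
      {e (v \<oplus>\<^bsub>V\<^esub> v') w \<ominus>\<^bsub>P\<^esub> (e v w \<oplus>\<^bsub>P\<^esub> e v' w) | v v' w.
        v \<in> carrier V \<and> v' \<in> carrier V \<and> w \<in> carrier W} \<union>
      {e v (w \<oplus>\<^bsub>W\<^esub> w') \<ominus>\<^bsub>P\<^esub> (e v w \<oplus>\<^bsub>P\<^esub> e v w') | v w w'.
        v \<in> carrier V \<and> w \<in> carrier W \<and> w' \<in> carrier W} \<union>
      {e (a \<odot>\<^bsub>V\<^esub> v) w \<ominus>\<^bsub>P\<^esub> a \<odot>\<^bsub>P\<^esub> e v w | a v w.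
        a \<in> carrier K \<and> v \<in> carrier V \<and> w \<in> carrier W} \<union>
      {e v (a \<odot>\<^bsub>W\<^esub> w) \<ominus>\<^bsub>P\<^esub> a \<odot>\<^bsub>P\<^esub> e v w | a v w.
        a \<in> carrier K \<and> v \<in> carrier V \<and> w \<in> carrier W})"

definition tensor_null ::
  "('k, 'r) ring_scheme \<Rightarrow> ('k, 'v, 'x) module_scheme \<Rightarrow> ('k, 'w, 'y) module_scheme
    \<Rightarrow> ('v \<times> 'w \<Rightarrow> 'k) set"
  where "tensor_null K V W =
    span_in K (free_space K (carrier V \<times> carrier W)) (tensor_relations K V W)"

type_synonym ('k, 'v, 'w) tensor = "('v \<times> 'w \<Rightarrow> 'k) set"

definition tensor ::
  "('k, 'r) ring_scheme \<Rightarrow> ('k, 'v, 'x) module_scheme \<Rightarrow> ('k, 'w, 'y) module_scheme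
    \<Rightarrow> ('k, ('k, 'v, 'w) tensor) module"
  where "tensor K V W =
    quotient_space (free_space K (carrier V \<times> carrier W)) (tensor_null K V W)"

definition tensor_pure ::
  "('k, 'r) ring_scheme \<Rightarrow> ('k, 'v, 'x) module_scheme \<Rightarrow> ('k, 'w, 'y) module_scheme
    \<Rightarrow> 'v \<Rightarrow> 'w \<Rightarrow> ('k, 'v, 'w) tensor"
  where "tensor_pure K V W v w =
    tensor_null K V W +>\<^bsub>free_space K (carrier V \<times> carrier W)\<^esub> free_gen K (v, w)"

text \<open>
  The linear map \<open>V \<otimes> W \<rightarrow> U\<close> induced by a bilinear map \<open>f\<close>: the class of a formal linear
  combination of pairs \<open>(v, w)\<close> goes to the corresponding linear combination of the \<open>f v w\<close>. For
  bilinear \<open>f\<close> the result does not depend on the representative, so the image is a singleton.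
  In Sweedler notation, the sum of \<open>f c\<^sub>(\<^sub>1\<^sub>) c\<^sub>(\<^sub>2\<^sub>)\<close> is \<open>tensor_lift K C C U f (comul C c)\<close>.
\<close>

definition tensor_lift ::
  "('k, 'r) ring_scheme \<Rightarrow> ('k, 'v, 'x) module_scheme \<Rightarrow> ('k, 'w, 'y) module_scheme
    \<Rightarrow> ('k, 'u, 'z) module_scheme \<Rightarrow> ('v \<Rightarrow> 'w \<Rightarrow> 'u) \<Rightarrow> ('k, 'v, 'w) tensor \<Rightarrow> 'u"
  where "tensor_lift K V W U f = (\<lambda>X\<in>carrier (tensor K V W).
    the_elem ((\<lambda>x. \<Oplus>\<^bsub>U\<^esub>p\<in>{p. x p \<noteq> \<zero>\<^bsub>K\<^esub>}. x p \<odot>\<^bsub>U\<^esub> f (fst p) (snd p)) ` X))"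

definition tensor_map ::
  "('k, 'r) ring_scheme \<Rightarrow> ('k, 'v, 'x) module_scheme \<Rightarrow> ('k, 'w, 'y) module_scheme
    \<Rightarrow> ('k, 'v2, 'x2) module_scheme \<Rightarrow> ('k, 'w2, 'y2) module_scheme
    \<Rightarrow> ('v \<Rightarrow> 'v2) \<Rightarrow> ('w \<Rightarrow> 'w2) \<Rightarrow> ('k, 'v, 'w) tensor \<Rightarrow> ('k, 'v2, 'w2) tensor"
  where "tensor_map K V W V' W' f g =
    tensor_lift K V W (tensor K V' W') (\<lambda>v w. tensor_pure K V' W' (f v) (g w))"

definition tensor_flip ::
  "('k, 'r) ring_scheme \<Rightarrow> ('k, 'v, 'x) module_scheme \<Rightarrow> ('k, 'w, 'y) module_scheme
    \<Rightarrow> ('k, 'v, 'w) tensor \<Rightarrow> ('k, 'w, 'v) tensor"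
  where "tensor_flip K V W = tensor_lift K V W (tensor K W V) (\<lambda>v w. tensor_pure K W V w v)"

text \<open>The canonical map \<open>(U \<otimes> V) \<otimes> W \<rightarrow> U \<otimes> (V \<otimes> W)\<close>, suppressed in the usual notation.\<close>

definition tensor_assoc ::
  "('k, 'r) ring_scheme \<Rightarrow> ('k, 'u, 'z) module_scheme \<Rightarrow> ('k, 'v, 'x) module_scheme
    \<Rightarrow> ('k, 'w, 'y) module_scheme
    \<Rightarrow> ('k, ('k, 'u, 'v) tensor, 'w) tensor \<Rightarrow> ('k, 'u, ('k, 'v, 'w) tensor) tensor"
  where "tensor_assoc K U V W =
    tensor_lift K (tensor K U V) W (tensor K U (tensor K V W))
      (\<lambda>t w. tensor_lift K U V (tensor K U (tensor K V W))
        (\<lambda>u v. tensor_pure K U (tensor K V W) u (tensor_pure K V W v w)) t)"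

definition tensor_assoc_inv ::
  "('k, 'r) ring_scheme \<Rightarrow> ('k, 'u, 'z) module_scheme \<Rightarrow> ('k, 'v, 'x) module_scheme
    \<Rightarrow> ('k, 'w, 'y) module_scheme
    \<Rightarrow> ('k, 'u, ('k, 'v, 'w) tensor) tensor \<Rightarrow> ('k, ('k, 'u, 'v) tensor, 'w) tensor"
  where "tensor_assoc_inv K U V W =
    tensor_lift K U (tensor K V W) (tensor K (tensor K U V) W)
      (\<lambda>u t. tensor_lift K V W (tensor K (tensor K U V) W)
        (\<lambda>v w. tensor_pure K (tensor K U V) W (tensor_pure K U V u v) w) t)"


section \<open>Coalgebras\<close>

record ('k, 'c) coalgebra = "('k, 'c) module" +
  comul :: "'c \<Rightarrow> ('k, 'c, 'c) tensor"
  counit :: "'c \<Rightarrow> 'k"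

locale coalgebra = module K C for K (structure) and C (structure) +
  assumes comul_linear: "is_linear K C (tensor K C C) (comul C)"
    and counit_linear: "is_linear K C (scalars K) (counit C)"
    and coassoc: "c \<in> carrier C \<Longrightarrow>
      tensor_assoc K C C C (tensor_map K C C (tensor K C C) C (comul C) (\<lambda>x. x) (comul C c)) =
      tensor_map K C C C (tensor K C C) (\<lambda>x. x) (comul C) (comul C c)"
    and counit_left: "c \<in> carrier C \<Longrightarrow>
      tensor_lift K C C C (\<lambda>c\<^sub>1 c\<^sub>2. counit C c\<^sub>1 \<odot>\<^bsub>C\<^esub> c\<^sub>2) (comul C c) = c"
    and counit_right: "c \<in> carrier C \<Longrightarrow>
      tensor_lift K C C C (\<lambda>c\<^sub>1 c\<^sub>2. counit C c\<^sub>2 \<odot>\<^bsub>C\<^esub> c\<^sub>1) (comul C c) = c"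

text \<open>\<open>\<epsilon>\<^sub>C \<otimes> \<epsilon>\<^sub>D\<close>, with \<open>k \<otimes> k\<close> identified with \<open>k\<close> by multiplication.\<close>

definition counit_tensor ::
  "('k, 'r) ring_scheme \<Rightarrow> ('k, 'c, 'x) coalgebra_scheme \<Rightarrow> ('k, 'd, 'y) coalgebra_scheme
    \<Rightarrow> ('k, 'c, 'd) tensor \<Rightarrow> 'k"
  where "counit_tensor K C D = tensor_lift K C D (scalars K) (\<lambda>c d. counit C c \<otimes>\<^bsub>K\<^esub> counit D d)"


section \<open>The two algebras\<close>

text \<open>The locale \<^locale>\<open>algebra\<close> of the library demands a commutative multiplication.\<close>

locale assoc_algebra = module K A + A?: ring A for K (structure) and A (structure) +
  assumes smult_mult_left: "\<lbrakk>a \<in> carrier K; x \<in> carrier A; y \<in> carrier A\<rbrakk> \<Longrightarrow>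
      (a \<odot>\<^bsub>A\<^esub> x) \<otimes>\<^bsub>A\<^esub> y = a \<odot>\<^bsub>A\<^esub> (x \<otimes>\<^bsub>A\<^esub> y)"
    and smult_mult_right: "\<lbrakk>a \<in> carrier K; x \<in> carrier A; y \<in> carrier A\<rbrakk> \<Longrightarrow>
      x \<otimes>\<^bsub>A\<^esub> (a \<odot>\<^bsub>A\<^esub> y) = a \<odot>\<^bsub>A\<^esub> (x \<otimes>\<^bsub>A\<^esub> y)"

definition algebra_iso ::
  "('k, 'r) ring_scheme \<Rightarrow> ('k, 'a, 'x) module_scheme \<Rightarrow> ('k, 'b, 'y) module_scheme
    \<Rightarrow> ('a \<Rightarrow> 'b) set"
  where "algebra_iso K A B = {h \<in> ring_iso A B. is_linear K A B h}"

definition left_colinear ::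
  "('k, 'r) ring_scheme \<Rightarrow> ('k, 'c, 'x) coalgebra_scheme \<Rightarrow> ('k, 'd, 'y) coalgebra_scheme
    \<Rightarrow> (('k, 'd, 'c) tensor \<Rightarrow> ('k, 'd, 'c) tensor) \<Rightarrow> bool"
  where "left_colinear K C D f \<longleftrightarrow>
    (let coact = (\<lambda>t. tensor_assoc K D D C (tensor_map K D C (tensor K D D) C (comul D) (\<lambda>x. x) t)) in
      \<forall>t\<in>carrier (tensor K D C).
        coact (f t) = tensor_map K D (tensor K D C) D (tensor K D C) (\<lambda>x. x) f (coact t))"

definition right_colinear ::
  "('k, 'r) ring_scheme \<Rightarrow> ('k, 'c, 'x) coalgebra_scheme \<Rightarrow> ('k, 'd, 'y) coalgebra_scheme
    \<Rightarrow> (('k, 'd, 'c) tensor \<Rightarrow> ('k, 'd, 'c) tensor) \<Rightarrow> bool"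
  where "right_colinear K C D f \<longleftrightarrow>
    (let coact = (\<lambda>t. tensor_assoc_inv K D C C (tensor_map K D C D (tensor K C C) (\<lambda>x. x) (comul C) t)) in
      \<forall>t\<in>carrier (tensor K D C).
        coact (f t) = tensor_map K (tensor K D C) C (tensor K D C) C f (\<lambda>x. x) (coact t))"

definition Tw ::
  "('k, 'r) ring_scheme \<Rightarrow> ('k, 'c, 'x) coalgebra_scheme \<Rightarrow> ('k, 'd, 'y) coalgebra_scheme
    \<Rightarrow> ('k, ('k, 'd, 'c) tensor \<Rightarrow> ('k, 'd, 'c) tensor) module"
  where "Tw K C D = (let T = tensor K D C in \<lparr>
    carrier = {f \<in> linear_maps K T T. left_colinear K C D f \<and> right_colinear K C D f},
    mult = compose (carrier T),
    one = (\<lambda>t\<in>carrier T. t),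
    zero = (\<lambda>t\<in>carrier T. \<zero>\<^bsub>T\<^esub>),
    add = (\<lambda>f g. \<lambda>t\<in>carrier T. f t \<oplus>\<^bsub>T\<^esub> g t),
    smult = (\<lambda>a f. \<lambda>t\<in>carrier T. a \<odot>\<^bsub>T\<^esub> f t)\<rparr>)"

text \<open>\<open>(\<phi> \<star> \<psi>)(c \<otimes> d) = \<phi>(c\<^sub>(\<^sub>2\<^sub>) \<otimes> d\<^sub>(\<^sub>1\<^sub>)) \<psi>(c\<^sub>(\<^sub>1\<^sub>) \<otimes> d\<^sub>(\<^sub>2\<^sub>))\<close>\<close>

definition star ::
  "('k, 'r) ring_scheme \<Rightarrow> ('k, 'c, 'x) coalgebra_scheme \<Rightarrow> ('k, 'd, 'y) coalgebra_scheme
    \<Rightarrow> (('k, 'c, 'd) tensor \<Rightarrow> 'k) \<Rightarrow> (('k, 'c, 'd) tensor \<Rightarrow> 'k) \<Rightarrow> ('k, 'c, 'd) tensor \<Rightarrow> 'k"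
  where "star K C D \<phi> \<psi> = tensor_lift K C D (scalars K) (\<lambda>c d.
    tensor_lift K C C (scalars K) (\<lambda>c\<^sub>1 c\<^sub>2.
      tensor_lift K D D (scalars K) (\<lambda>d\<^sub>1 d\<^sub>2.
        \<phi> (tensor_pure K C D c\<^sub>2 d\<^sub>1) \<otimes>\<^bsub>K\<^esub> \<psi> (tensor_pure K C D c\<^sub>1 d\<^sub>2))
      (comul D d))
    (comul C c))"

definition dual_alg ::
  "('k, 'r) ring_scheme \<Rightarrow> ('k, 'c, 'x) coalgebra_scheme \<Rightarrow> ('k, 'd, 'y) coalgebra_scheme
    \<Rightarrow> ('k, ('k, 'c, 'd) tensor \<Rightarrow> 'k) module"
  where "dual_alg K C D = (let T = tensor K C D in \<lparr>
    carrier = linear_maps K T (scalars K),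
    mult = star K C D,
    one = counit_tensor K C D,
    zero = (\<lambda>t\<in>carrier T. \<zero>\<^bsub>K\<^esub>),
    add = (\<lambda>\<phi> \<psi>. \<lambda>t\<in>carrier T. \<phi> t \<oplus>\<^bsub>K\<^esub> \<psi> t),
    smult = (\<lambda>a \<phi>. \<lambda>t\<in>carrier T. a \<otimes>\<^bsub>K\<^esub> \<phi> t)\<rparr>)"

definition F_map ::
  "('k, 'r) ring_scheme \<Rightarrow> ('k, 'c, 'x) coalgebra_scheme \<Rightarrow> ('k, 'd, 'y) coalgebra_scheme
    \<Rightarrow> (('k, 'd, 'c) tensor \<Rightarrow> ('k, 'd, 'c) tensor) \<Rightarrow> ('k, 'c, 'd) tensor \<Rightarrow> 'k"
  where "F_map K C D f =
    (let \<Psi> = compose (carrier (tensor K C D)) f (tensor_flip K C D)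
     in compose (carrier (tensor K C D)) (counit_tensor K D C) \<Psi>)"

end

theory Submission
  imports Defs
begin

text \<open>
  A map \<open>\<Psi>'\<close> that is left \<open>D\<close>-colinear is determined by \<open>(\<epsilon>\<^sub>D \<otimes> id) \<Psi>'\<close>: counting the factor \<open>D\<close>
  off with \<open>\<epsilon>\<^sub>D\<close> after the coaction gives the identity, and colinearity lets the coaction pass
  through \<open>\<Psi>'\<close>, whence \<open>\<Psi>'(d \<otimes> c) = d\<^sub>(\<^sub>1\<^sub>) \<otimes> (\<epsilon>\<^sub>D \<otimes> id) \<Psi>'(d\<^sub>(\<^sub>2\<^sub>) \<otimes> c)\<close>. Right \<open>C\<close>-colinearity
  gives the mirror image of this formula. Both together yield, with \<open>\<phi> = F(\<Psi>')\<close>,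
    \<open>\<Psi>'(d \<otimes> c) = \<phi>(c\<^sub>(\<^sub>1\<^sub>) \<otimes> d\<^sub>(\<^sub>2\<^sub>)) d\<^sub>(\<^sub>1\<^sub>) \<otimes> c\<^sub>(\<^sub>2\<^sub>)\<close>   (\<open>twist_F_map_pure\<close>).
  For any functional \<open>\<phi>\<close> the right side defines a map (\<open>twist\<close>) that is colinear on both sides by
  coassociativity of \<open>D\<close> and of \<open>C\<close> (\<open>twist_left_colinear\<close>, \<open>twist_right_colinear\<close>), and that \<open>F\<close>
  sends back to \<open>\<phi>\<close> by counitality (\<open>F_map_twist_pure\<close>). So \<open>F\<close> is bijective. Applying
  \<open>(\<epsilon>\<^sub>D \<otimes> \<epsilon>\<^sub>C) f\<close> to the formula for \<open>g\<close> gives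
    \<open>F(f \<circ> g)(c \<otimes> d) = (\<epsilon>\<^sub>D \<otimes> \<epsilon>\<^sub>C) f(g(d \<otimes> c)) = F(f)(c\<^sub>(\<^sub>2\<^sub>) \<otimes> d\<^sub>(\<^sub>1\<^sub>)) F(g)(c\<^sub>(\<^sub>1\<^sub>) \<otimes> d\<^sub>(\<^sub>2\<^sub>))\<close>,
  and the right side is \<open>(F(f) \<star> F(g))(c \<otimes> d)\<close> (\<open>F_map_mult\<close>).

  That the colinear maps form an algebra under composition is clear, since they are the linear maps
  commuting with two coactions. The algebra axioms for \<open>\<star>\<close> are then carried over along the
  surjective map \<open>F\<close>, which preserves all operations (\<open>assoc_algebra_image\<close>), so that associativity
  of \<open>\<star>\<close> is a consequence of associativity of composition.

  The computations with Sweedler sums rest on three properties of the tensor product: a bilinear map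
  lifts to a linear one (\<open>tensor_lift_linear\<close>, \<open>tensor_lift_pure\<close>), linear maps that agree on pure
  tensors agree (\<open>tensor_linear_eqI\<close>), and the lift depends linearly on the bilinear map
  (\<open>is_linear_tensor_lift_param\<close>). The last one makes an iterated Sweedler sum linear in each of
  its variables, so that multilinearity can be checked by syntax-directed rules.
\<close>

section \<open>Linear maps and modules\<close>

lemma is_linearI:
  assumes "\<And>x. x \<in> carrier V \<Longrightarrow> f x \<in> carrier W"
    and "\<And>x y. \<lbrakk>x \<in> carrier V; y \<in> carrier V\<rbrakk> \<Longrightarrow> f (x \<oplus>\<^bsub>V\<^esub> y) = f x \<oplus>\<^bsub>W\<^esub> f y"
    and "\<And>a x. \<lbrakk>a \<in> carrier K; x \<in> carrier V\<rbrakk> \<Longrightarrow> f (a \<odot>\<^bsub>V\<^esub> x) = a \<odot>\<^bsub>W\<^esub> f x"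
  shows "is_linear K V W f"
  using assms by (auto simp: is_linear_def)

lemma is_linearD:
  assumes "is_linear K V W f"
  shows "x \<in> carrier V \<Longrightarrow> f x \<in> carrier W"
    and "\<lbrakk>x \<in> carrier V; y \<in> carrier V\<rbrakk> \<Longrightarrow> f (x \<oplus>\<^bsub>V\<^esub> y) = f x \<oplus>\<^bsub>W\<^esub> f y"
    and "\<lbrakk>a \<in> carrier K; x \<in> carrier V\<rbrakk> \<Longrightarrow> f (a \<odot>\<^bsub>V\<^esub> x) = a \<odot>\<^bsub>W\<^esub> f x"
  using assms by (auto simp: is_linear_def)

lemma is_linear_zero:
  assumes "module K V" "module K W" "is_linear K V W f"
  shows "f \<zero>\<^bsub>V\<^esub> = \<zero>\<^bsub>W\<^esub>"
proof -
  interpret V: module K V by fact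
  interpret W: module K W by fact
  have "f \<zero>\<^bsub>V\<^esub> = f (\<zero>\<^bsub>K\<^esub> \<odot>\<^bsub>V\<^esub> \<zero>\<^bsub>V\<^esub>)" by simp
  also have "\<dots> = \<zero>\<^bsub>K\<^esub> \<odot>\<^bsub>W\<^esub> f \<zero>\<^bsub>V\<^esub>" by (rule is_linearD(3)[OF assms(3)]) auto
  also have "\<dots> = \<zero>\<^bsub>W\<^esub>" using is_linearD(1)[OF assms(3)] by simp
  finally show ?thesis .
qed

lemma is_linear_cong:
  assumes "module K V" "is_linear K V W f" "\<And>x. x \<in> carrier V \<Longrightarrow> f x = g x"
  shows "is_linear K V W g"
proof -
  interpret V: module K V by fact
  show ?thesis
    using assms(3) is_linearD[OF assms(2)]
    by (intro is_linearI) (metis V.add.m_closed V.smult_closed)+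
qed

lemma is_linear_restrict:
  assumes "module K V" "is_linear K V W f"
  shows "is_linear K V W (\<lambda>x\<in>carrier V. f x)"
  by (rule is_linear_cong[OF assms]) simp

lemma is_linear_id: "is_linear K V V (\<lambda>x. x)"
  by (rule is_linearI) auto

lemma is_linear_compose:
  assumes "is_linear K W U g" "is_linear K V W f"
  shows "is_linear K V U (\<lambda>x. g (f x))"
  using is_linearD[OF assms(1)] is_linearD[OF assms(2)] by (intro is_linearI) auto

lemma is_linear_add:
  assumes "module K W" "is_linear K V W f" "is_linear K V W g"
  shows "is_linear K V W (\<lambda>x. f x \<oplus>\<^bsub>W\<^esub> g x)"
proof -
  interpret W: module K W by fact
  show ?thesis
    using is_linearD[OF assms(2)] is_linearD[OF assms(3)]
    by (intro is_linearI) (auto simp: W.smult_r_distr W.a_ac)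
qed

lemma is_linear_smult:
  assumes "module K W" "is_linear K V W f" "a \<in> carrier K"
  shows "is_linear K V W (\<lambda>x. a \<odot>\<^bsub>W\<^esub> f x)"
proof -
  interpret W: module K W by fact
  show ?thesis
    using is_linearD[OF assms(2)] assms(3)
    by (intro is_linearI) (auto simp: W.smult_r_distr W.smult_assoc1[symmetric] W.m_comm)
qed

lemma is_linear_smult_const:
  assumes "module K U" "is_linear K V (scalars K) f" "u \<in> carrier U"
  shows "is_linear K V U (\<lambda>x. f x \<odot>\<^bsub>U\<^esub> u)"
proof -
  interpret U: module K U by fact
  show ?thesis
    using is_linearD[OF assms(2)] assms(3)
    by (intro is_linearI) (auto simp: scalars_def U.smult_l_distr U.smult_assoc1)
qed

lemma scalars_simps [simp]:
  "carrier (scalars K) = carrier K" "add (scalars K) = add K" "zero (scalars K) = zero K"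
  "smult (scalars K) = mult K"
  by (simp_all add: scalars_def)

lemma module_scalars:
  assumes "cring K"
  shows "module K (scalars K)"
proof -
  interpret cring K by fact
  show ?thesis
    by (intro moduleI abelian_groupI)
      (auto simp: cring_axioms a_ac m_ac l_distr r_distr intro: add.l_inv_ex)
qed

lemma is_linear_mult:
  assumes "cring K" "is_linear K V (scalars K) f" "a \<in> carrier K"
  shows "is_linear K V (scalars K) (\<lambda>x. a \<otimes>\<^bsub>K\<^esub> f x)"
    and "is_linear K V (scalars K) (\<lambda>x. f x \<otimes>\<^bsub>K\<^esub> a)"
  using is_linear_smult[OF module_scalars assms(2,3)]
    is_linear_smult_const[OF module_scalars assms(2), of a] assms by simp_all

text \<open>
  The module axioms hold for functions on \<open>S\<close> because they hold at each point of \<open>S\<close>, so a set of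
  functions need only be closed under the operations; the additive inverse is the multiple by \<open>-1\<close>.
  Free spaces (\<open>S = UNIV\<close>, values in the field) and spaces of linear maps are of this form.
\<close>

lemma module_pointwise:
  assumes "module K W"
    and ext: "\<And>f. f \<in> carrier A \<Longrightarrow> f \<in> extensional S"
    and val: "\<And>f s. \<lbrakk>f \<in> carrier A; s \<in> S\<rbrakk> \<Longrightarrow> f s \<in> carrier W"
    and zero: "\<zero>\<^bsub>A\<^esub> = (\<lambda>s\<in>S. \<zero>\<^bsub>W\<^esub>)" "\<zero>\<^bsub>A\<^esub> \<in> carrier A"
    and add: "\<And>f g. \<lbrakk>f \<in> carrier A; g \<in> carrier A\<rbrakk> \<Longrightarrow> f \<oplus>\<^bsub>A\<^esub> g = (\<lambda>s\<in>S. f s \<oplus>\<^bsub>W\<^esub> g s)"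
      "\<And>f g. \<lbrakk>f \<in> carrier A; g \<in> carrier A\<rbrakk> \<Longrightarrow> f \<oplus>\<^bsub>A\<^esub> g \<in> carrier A"
    and smult: "\<And>a f. \<lbrakk>a \<in> carrier K; f \<in> carrier A\<rbrakk> \<Longrightarrow> a \<odot>\<^bsub>A\<^esub> f = (\<lambda>s\<in>S. a \<odot>\<^bsub>W\<^esub> f s)"
      "\<And>a f. \<lbrakk>a \<in> carrier K; f \<in> carrier A\<rbrakk> \<Longrightarrow> a \<odot>\<^bsub>A\<^esub> f \<in> carrier A"
  shows "module K A"
proof -
  interpret W: module K W by fact
  have eqI: "f = g" if "f \<in> carrier A" "g \<in> carrier A" "\<And>s. s \<in> S \<Longrightarrow> f s = g s" for f g
    using that ext by (blast intro: extensionalityI)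
  have app: "(f \<oplus>\<^bsub>A\<^esub> g) s = f s \<oplus>\<^bsub>W\<^esub> g s" if "f \<in> carrier A" "g \<in> carrier A" "s \<in> S" for f g s
    using that add(1) by simp
  have app2: "(a \<odot>\<^bsub>A\<^esub> f) s = a \<odot>\<^bsub>W\<^esub> f s" if "f \<in> carrier A" "a \<in> carrier K" "s \<in> S" for f a s
    using that smult(1) by simp
  have app0: "\<zero>\<^bsub>A\<^esub> s = \<zero>\<^bsub>W\<^esub>" if "s \<in> S" for s
    using that zero by simp
  show ?thesis
  proof (intro moduleI abelian_groupI)
    fix f assume f: "f \<in> carrier A"
    let ?g = "(\<ominus>\<^bsub>K\<^esub> \<one>\<^bsub>K\<^esub>) \<odot>\<^bsub>A\<^esub> f"
    have "?g \<oplus>\<^bsub>A\<^esub> f = \<zero>\<^bsub>A\<^esub>"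
      using f val by (intro eqI)
        (simp_all add: add(2) smult(2) zero(2) app app2 app0 W.smult_l_minus W.M.l_neg)
    then show "\<exists>g\<in>carrier A. g \<oplus>\<^bsub>A\<^esub> f = \<zero>\<^bsub>A\<^esub>" using f smult(2) by blast
  qed (auto simp: W.R.cring_axioms add(2) smult(2) zero(2) intro!: eqI,
      auto simp: app app2 app0 add(2) smult(2) zero(2) val W.a_ac W.smult_l_distr W.smult_r_distr
        W.smult_assoc1)
qed

text \<open>
  The axioms of a module are equations between the operations, including negation, so they pass to
  the image of a map that preserves the operations.
\<close>

lemma module_image:
  assumes "module K V"
    and surj: "h ` carrier V = carrier Q"
    and zero: "h \<zero>\<^bsub>V\<^esub> = \<zero>\<^bsub>Q\<^esub>"
    and add: "\<And>x y. \<lbrakk>x \<in> carrier V; y \<in> carrier V\<rbrakk> \<Longrightarrow> h (x \<oplus>\<^bsub>V\<^esub> y) = h x \<oplus>\<^bsub>Q\<^esub> h y"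
    and smult: "\<And>a x. \<lbrakk>a \<in> carrier K; x \<in> carrier V\<rbrakk> \<Longrightarrow> h (a \<odot>\<^bsub>V\<^esub> x) = a \<odot>\<^bsub>Q\<^esub> h x"
  shows "module K Q"
proof -
  interpret V: module K V by fact
  have Q: "\<exists>u\<in>carrier V. x = h u" if "x \<in> carrier Q" for x using surj that by auto
  have h: "h u \<in> carrier Q" if "u \<in> carrier V" for u using surj that by auto
  show ?thesis
  proof (intro moduleI abelian_groupI)
    show "cring K" by (rule V.R.cring_axioms)
    show "\<zero>\<^bsub>Q\<^esub> \<in> carrier Q" using h[of "\<zero>\<^bsub>V\<^esub>"] zero by simp
  next
    fix x assume "x \<in> carrier Q"
    then obtain u where u: "u \<in> carrier V" "x = h u" using Q by blast
    have "h (\<ominus>\<^bsub>V\<^esub> u) \<oplus>\<^bsub>Q\<^esub> x = \<zero>\<^bsub>Q\<^esub>"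
      using u add[of "\<ominus>\<^bsub>V\<^esub> u" u] zero by (simp add: V.M.l_neg)
    then show "\<exists>z\<in>carrier Q. z \<oplus>\<^bsub>Q\<^esub> x = \<zero>\<^bsub>Q\<^esub>" using h u by blast
    show "\<zero>\<^bsub>Q\<^esub> \<oplus>\<^bsub>Q\<^esub> x = x" using u add[of "\<zero>\<^bsub>V\<^esub>" u] zero by simp
    show "\<one>\<^bsub>K\<^esub> \<odot>\<^bsub>Q\<^esub> x = x" using u smult[of "\<one>\<^bsub>K\<^esub>" u] by simp
    fix a assume a: "a \<in> carrier K"
    show "a \<odot>\<^bsub>Q\<^esub> x \<in> carrier Q" using u a smult h[of "a \<odot>\<^bsub>V\<^esub> u"] by simp
    fix b assume b: "b \<in> carrier K"
    show "(a \<oplus>\<^bsub>K\<^esub> b) \<odot>\<^bsub>Q\<^esub> x = a \<odot>\<^bsub>Q\<^esub> x \<oplus>\<^bsub>Q\<^esub> b \<odot>\<^bsub>Q\<^esub> x"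
      using u a b by (simp add: V.smult_l_distr flip: add smult)
    show "(a \<otimes>\<^bsub>K\<^esub> b) \<odot>\<^bsub>Q\<^esub> x = a \<odot>\<^bsub>Q\<^esub> (b \<odot>\<^bsub>Q\<^esub> x)"
      using u a b by (simp add: V.smult_assoc1 flip: smult)
  next
    fix x y assume "x \<in> carrier Q" "y \<in> carrier Q"
    then obtain u v where u: "u \<in> carrier V" "x = h u" and v: "v \<in> carrier V" "y = h v"
      using Q by blast
    show "x \<oplus>\<^bsub>Q\<^esub> y \<in> carrier Q" using u v add h[of "u \<oplus>\<^bsub>V\<^esub> v"] by simp
    show "x \<oplus>\<^bsub>Q\<^esub> y = y \<oplus>\<^bsub>Q\<^esub> x" using u v by (simp add: V.M.a_comm flip: add)
    show "a \<odot>\<^bsub>Q\<^esub> (x \<oplus>\<^bsub>Q\<^esub> y) = a \<odot>\<^bsub>Q\<^esub> x \<oplus>\<^bsub>Q\<^esub> a \<odot>\<^bsub>Q\<^esub> y" if "a \<in> carrier K" for a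
      using u v that by (simp add: V.smult_r_distr flip: add smult)
    fix z assume "z \<in> carrier Q"
    then obtain w where w: "w \<in> carrier V" "z = h w" using Q by blast
    show "(x \<oplus>\<^bsub>Q\<^esub> y) \<oplus>\<^bsub>Q\<^esub> z = x \<oplus>\<^bsub>Q\<^esub> (y \<oplus>\<^bsub>Q\<^esub> z)"
      using u v w by (simp add: V.M.a_assoc flip: add)
  qed
qed

text \<open>
  The counterpart of \<open>module_image\<close> for algebras, by which the dual algebra inherits its axioms from
  the colinear maps.
\<close>

lemma assoc_algebra_image:
  assumes "assoc_algebra K A" and h: "h \<in> ring_hom A B" and surj: "h ` carrier A = carrier B"
    and zero: "h \<zero>\<^bsub>A\<^esub> = \<zero>\<^bsub>B\<^esub>"
    and smult: "\<And>a x. \<lbrakk>a \<in> carrier K; x \<in> carrier A\<rbrakk> \<Longrightarrow> h (a \<odot>\<^bsub>A\<^esub> x) = a \<odot>\<^bsub>B\<^esub> h x"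
  shows "assoc_algebra K B"
proof -
  interpret A: assoc_algebra K A by fact
  have "ring (B\<lparr>carrier := h ` carrier A, zero := h \<zero>\<^bsub>A\<^esub>\<rparr>)"
    by (rule A.ring_hom_imp_img_ring[OF h])
  then have ring: "ring B" unfolding surj zero by simp
  have mod: "module K B"
    by (rule module_image[OF A.module_axioms surj zero ring_hom_add[OF h] smult])
  have "(a \<odot>\<^bsub>B\<^esub> x) \<otimes>\<^bsub>B\<^esub> y = a \<odot>\<^bsub>B\<^esub> (x \<otimes>\<^bsub>B\<^esub> y)" "x \<otimes>\<^bsub>B\<^esub> (a \<odot>\<^bsub>B\<^esub> y) = a \<odot>\<^bsub>B\<^esub> (x \<otimes>\<^bsub>B\<^esub> y)"
    if a: "a \<in> carrier K" and xy: "x \<in> carrier B" "y \<in> carrier B" for a x y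
  proof -
    obtain u v where u: "u \<in> carrier A" "x = h u" and v: "v \<in> carrier A" "y = h v"
      using xy unfolding surj[symmetric] by blast
    show "(a \<odot>\<^bsub>B\<^esub> x) \<otimes>\<^bsub>B\<^esub> y = a \<odot>\<^bsub>B\<^esub> (x \<otimes>\<^bsub>B\<^esub> y)" "x \<otimes>\<^bsub>B\<^esub> (a \<odot>\<^bsub>B\<^esub> y) = a \<odot>\<^bsub>B\<^esub> (x \<otimes>\<^bsub>B\<^esub> y)"
      using u v a A.smult_mult_left[of a u v] A.smult_mult_right[of a u v]
      by (simp_all flip: smult ring_hom_mult[OF h])
  qed
  then show ?thesis by (intro assoc_algebra.intro assoc_algebra_axioms.intro mod ring)
qed

section \<open>Free spaces and quotients\<close>

lemma free_space_simps [simp]: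
  "carrier (free_space K S) =
    {x. range x \<subseteq> carrier K \<and> {s. x s \<noteq> \<zero>\<^bsub>K\<^esub>} \<subseteq> S \<and> finite {s. x s \<noteq> \<zero>\<^bsub>K\<^esub>}}"
  "zero (free_space K S) = (\<lambda>s. \<zero>\<^bsub>K\<^esub>)"
  "add (free_space K S) = (\<lambda>x y s. x s \<oplus>\<^bsub>K\<^esub> y s)"
  "smult (free_space K S) = (\<lambda>a x s. a \<otimes>\<^bsub>K\<^esub> x s)"
  by (simp_all add: free_space_def)

lemma module_free_space:
  assumes "cring K"
  shows "module K (free_space K S)"
proof -
  interpret cring K by fact
  show ?thesis
  proof (rule module_pointwise[where S = UNIV, OF module_scalars[OF assms]])
    fix x y a
    assume x: "x \<in> carrier (free_space K S)"
    then have xK: "x s \<in> carrier K" for s by auto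
    show "x s \<in> carrier (scalars K)" for s using xK by simp
    {
      assume y: "y \<in> carrier (free_space K S)"
      then have yK: "y s \<in> carrier K" for s by auto
      have "{s. x s \<oplus>\<^bsub>K\<^esub> y s \<noteq> \<zero>\<^bsub>K\<^esub>} \<subseteq> {s. x s \<noteq> \<zero>\<^bsub>K\<^esub>} \<union> {s. y s \<noteq> \<zero>\<^bsub>K\<^esub>}" by auto
      then have "finite {s. x s \<oplus>\<^bsub>K\<^esub> y s \<noteq> \<zero>\<^bsub>K\<^esub>}" "{s. x s \<oplus>\<^bsub>K\<^esub> y s \<noteq> \<zero>\<^bsub>K\<^esub>} \<subseteq> S"
        using x y by (auto intro: finite_subset)
      then show "x \<oplus>\<^bsub>free_space K S\<^esub> y \<in> carrier (free_space K S)"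
        using xK yK by auto
    }
    {
      assume a: "a \<in> carrier K"
      have "{s. a \<otimes>\<^bsub>K\<^esub> x s \<noteq> \<zero>\<^bsub>K\<^esub>} \<subseteq> {s. x s \<noteq> \<zero>\<^bsub>K\<^esub>}" using a by auto
      then have "finite {s. a \<otimes>\<^bsub>K\<^esub> x s \<noteq> \<zero>\<^bsub>K\<^esub>}" "{s. a \<otimes>\<^bsub>K\<^esub> x s \<noteq> \<zero>\<^bsub>K\<^esub>} \<subseteq> S"
        using x by (auto intro: finite_subset)
      then show "a \<odot>\<^bsub>free_space K S\<^esub> x \<in> carrier (free_space K S)"
        using xK a by auto
    }
  qed (simp_all add: restrict_def)
qed

lemma free_gen_closed:
  assumes "cring K" "s \<in> S"
  shows "free_gen K s \<in> carrier (free_space K S)"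
proof -
  interpret cring K by fact
  have "{t. free_gen K s t \<noteq> \<zero>\<^bsub>K\<^esub>} \<subseteq> {s}" by (auto simp: free_gen_def)
  then show ?thesis using assms(2)
    by (auto intro: finite_subset simp: free_gen_def)
qed

text \<open>
  Removing one point from the support subtracts a multiple of a generator, so induction on the
  support applies.
\<close>

lemma free_space_generated:
  assumes "cring K" and N: "submodule N K (free_space K S)" and gen: "\<And>s. s \<in> S \<Longrightarrow> free_gen K s \<in> N"
    and x: "x \<in> carrier (free_space K S)"
  shows "x \<in> N"
proof -
  interpret cring K by fact
  interpret P: module K "free_space K S" by (rule module_free_space) fact
  note NE = P.submoduleE[OF N]
  have zero: "(\<lambda>s. \<zero>\<^bsub>K\<^esub>) \<in> N"
    using N subgroup.one_closed[OF submodule.axioms(1)[OF N]] by simp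
  have "{s. x s \<noteq> \<zero>\<^bsub>K\<^esub>} \<subseteq> A \<Longrightarrow> A \<subseteq> S \<Longrightarrow> range x \<subseteq> carrier K \<Longrightarrow> x \<in> N" if "finite A" for A
    using that
  proof (induction A arbitrary: x)
    case empty
    then have "x = (\<lambda>s. \<zero>\<^bsub>K\<^esub>)" by auto
    then show ?case using zero by simp
  next
    case (insert p A)
    have xK: "x s \<in> carrier K" for s using insert.prems by auto
    let ?y = "x(p := \<zero>\<^bsub>K\<^esub>)"
    have "?y \<in> N" by (rule insert.IH) (use insert.prems in \<open>auto simp: xK\<close>)
    moreover have "x p \<odot>\<^bsub>free_space K S\<^esub> free_gen K p \<in> N"
      using insert.prems by (intro NE(4) gen xK) auto
    ultimately have "x p \<odot>\<^bsub>free_space K S\<^esub> free_gen K p \<oplus>\<^bsub>free_space K S\<^esub> ?y \<in> N"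
      by (intro NE(5))
    moreover have "x p \<odot>\<^bsub>free_space K S\<^esub> free_gen K p \<oplus>\<^bsub>free_space K S\<^esub> ?y = x"
      by (auto simp: fun_eq_iff free_gen_def xK)
    ultimately show ?case by simp
  qed
  then show ?thesis using x by auto
qed

text \<open>
  This is the sum inside \<^const>\<open>tensor_lift\<close>, before passing to cosets.
\<close>

definition lin_ext ::
  "('k, 'r) ring_scheme \<Rightarrow> ('k, 'u, 'z) module_scheme \<Rightarrow> ('s \<Rightarrow> 'u) \<Rightarrow> ('s \<Rightarrow> 'k) \<Rightarrow> 'u"
  where "lin_ext K U g x = (\<Oplus>\<^bsub>U\<^esub>p\<in>{p. x p \<noteq> \<zero>\<^bsub>K\<^esub>}. x p \<odot>\<^bsub>U\<^esub> g p)"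

text \<open>
  The supports of two elements and of their sum differ; additivity is proved by summing over a common
  finite set.
\<close>

lemma lin_ext_superset:
  assumes "module K U" "finite A" "{p. x p \<noteq> \<zero>\<^bsub>K\<^esub>} \<subseteq> A" "range x \<subseteq> carrier K"
    and "\<And>p. p \<in> A \<Longrightarrow> g p \<in> carrier U"
  shows "lin_ext K U g x = (\<Oplus>\<^bsub>U\<^esub>p\<in>A. x p \<odot>\<^bsub>U\<^esub> g p)"
proof -
  interpret U: module K U by fact
  have xK: "x s \<in> carrier K" for s using assms by auto
  show ?thesis unfolding lin_ext_def
    by (rule U.add.finprod_mono_neutral_cong_left) (use assms in \<open>auto simp: xK\<close>)
qed

lemma lin_ext_linear:
  assumes "module K U" and g: "\<And>s. s \<in> S \<Longrightarrow> g s \<in> carrier U"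
  shows "is_linear K (free_space K S) U (lin_ext K U g)"
proof -
  interpret U: module K U by fact
  show ?thesis
  proof (rule is_linearI)
    fix x assume x: "x \<in> carrier (free_space K S)"
    then have xK: "x s \<in> carrier K" for s by auto
    show "lin_ext K U g x \<in> carrier U" unfolding lin_ext_def
      using x xK g by (intro U.finsum_closed) auto
    fix a assume a: "a \<in> carrier K"
    let ?A = "{p. x p \<noteq> \<zero>\<^bsub>K\<^esub>}"
    have "lin_ext K U g (a \<odot>\<^bsub>free_space K S\<^esub> x) = (\<Oplus>\<^bsub>U\<^esub>p\<in>?A. (a \<otimes>\<^bsub>K\<^esub> x p) \<odot>\<^bsub>U\<^esub> g p)"
      by (subst lin_ext_superset[OF assms(1), of ?A]) (use x xK a g in auto)
    also have "\<dots> = (\<Oplus>\<^bsub>U\<^esub>p\<in>?A. a \<odot>\<^bsub>U\<^esub> (x p \<odot>\<^bsub>U\<^esub> g p))"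
      by (rule U.finsum_cong') (use x xK a g in \<open>auto simp: U.smult_assoc1\<close>)
    also have "\<dots> = a \<odot>\<^bsub>U\<^esub> lin_ext K U g x" unfolding lin_ext_def
      by (subst U.finsum_smult_ldistr) (use x xK a g in \<open>auto intro!: U.smult_closed\<close>)
    finally show "lin_ext K U g (a \<odot>\<^bsub>free_space K S\<^esub> x) = a \<odot>\<^bsub>U\<^esub> lin_ext K U g x" .
  next
    fix x y assume x: "x \<in> carrier (free_space K S)" and y: "y \<in> carrier (free_space K S)"
    then have xK: "x s \<in> carrier K" "y s \<in> carrier K" for s by auto
    let ?A = "{p. x p \<noteq> \<zero>\<^bsub>K\<^esub>} \<union> {p. y p \<noteq> \<zero>\<^bsub>K\<^esub>}"
    have A: "finite ?A" "?A \<subseteq> S" using x y by auto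
    have gA: "p \<in> ?A \<Longrightarrow> g p \<in> carrier U" for p using A g by blast
    have "lin_ext K U g (x \<oplus>\<^bsub>free_space K S\<^esub> y) = (\<Oplus>\<^bsub>U\<^esub>p\<in>?A. (x p \<oplus>\<^bsub>K\<^esub> y p) \<odot>\<^bsub>U\<^esub> g p)"
      by (subst lin_ext_superset[OF assms(1) A(1)]) (use A gA xK in auto)
    also have "\<dots> = (\<Oplus>\<^bsub>U\<^esub>p\<in>?A. x p \<odot>\<^bsub>U\<^esub> g p \<oplus>\<^bsub>U\<^esub> y p \<odot>\<^bsub>U\<^esub> g p)"
      by (rule U.finsum_cong') (use xK gA in \<open>auto simp: U.smult_l_distr\<close>)
    also have "\<dots> = (\<Oplus>\<^bsub>U\<^esub>p\<in>?A. x p \<odot>\<^bsub>U\<^esub> g p) \<oplus>\<^bsub>U\<^esub> (\<Oplus>\<^bsub>U\<^esub>p\<in>?A. y p \<odot>\<^bsub>U\<^esub> g p)"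
      by (rule U.finsum_addf) (use xK gA in auto)
    also have "\<dots> = lin_ext K U g x \<oplus>\<^bsub>U\<^esub> lin_ext K U g y"
      using x y gA A(1) by (subst (1 2) lin_ext_superset[OF assms(1) A(1)]) auto
    finally show "lin_ext K U g (x \<oplus>\<^bsub>free_space K S\<^esub> y) = lin_ext K U g x \<oplus>\<^bsub>U\<^esub> lin_ext K U g y" .
  qed
qed

lemma lin_ext_gen:
  assumes "module K U" "g s \<in> carrier U"
  shows "lin_ext K U g (free_gen K s) = g s"
proof -
  interpret U: module K U by fact
  show ?thesis
    by (subst lin_ext_superset[OF assms(1), of "{s}"]) (use assms in \<open>auto simp: free_gen_def\<close>)
qed

lemma submodule_span:
  assumes "module K V" "A \<subseteq> carrier V"
  shows "submodule (span_in K V A) K V" "A \<subseteq> span_in K V A"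
    "submodule N K V \<Longrightarrow> A \<subseteq> N \<Longrightarrow> span_in K V A \<subseteq> N"
proof -
  interpret V: module K V by fact
  have ex: "carrier V \<in> {N. submodule N K V \<and> A \<subseteq> N}"
    using assms V.carrier_is_submodule by auto
  show "submodule (span_in K V A) K V" unfolding span_in_def
  proof (rule V.submoduleI)
    show "\<Inter>{N. submodule N K V \<and> A \<subseteq> N} \<subseteq> carrier V" using ex by blast
    show "\<zero>\<^bsub>V\<^esub> \<in> \<Inter>{N. submodule N K V \<and> A \<subseteq> N}"
      by (simp, metis monoid.select_convs(2) subgroup.one_closed submodule.axioms(1))
  next
    fix x assume x: "x \<in> \<Inter>{N. submodule N K V \<and> A \<subseteq> N}"
    show "\<ominus>\<^bsub>V\<^esub> x \<in> \<Inter>{N. submodule N K V \<and> A \<subseteq> N}"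
      using x by (simp add: V.submoduleE(3))
    show "a \<odot>\<^bsub>V\<^esub> x \<in> \<Inter>{N. submodule N K V \<and> A \<subseteq> N}" if "a \<in> carrier K" for a
      using x that by (simp add: V.submoduleE(4))
    show "x \<oplus>\<^bsub>V\<^esub> y \<in> \<Inter>{N. submodule N K V \<and> A \<subseteq> N}"
      if "y \<in> \<Inter>{N. submodule N K V \<and> A \<subseteq> N}" for y
      using x that by (simp add: V.submoduleE(5))
  qed
  show "A \<subseteq> span_in K V A" unfolding span_in_def by auto
  show "submodule N K V \<Longrightarrow> A \<subseteq> N \<Longrightarrow> span_in K V A \<subseteq> N" unfolding span_in_def by auto
qed

lemma quotient_space_props:
  assumes "module K V" "submodule N K V"
  shows "module K (quotient_space V N)"
    and "is_linear K V (quotient_space V N) (\<lambda>x. N +>\<^bsub>V\<^esub> x)"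
    and "carrier (quotient_space V N) = (\<lambda>x. N +>\<^bsub>V\<^esub> x) ` carrier V"
    and "x \<in> N \<Longrightarrow> N +>\<^bsub>V\<^esub> x = \<zero>\<^bsub>quotient_space V N\<^esub>"
proof -
  interpret V: module K V by fact
  note NE = V.submoduleE[OF assms(2)]
  interpret N: abelian_subgroup N V
    using assms(2) by (intro abelian_subgroupI3 additive_subgroupI V.abelian_group_axioms submodule.axioms(1))
  show car: "carrier (quotient_space V N) = (\<lambda>x. N +>\<^bsub>V\<^esub> x) ` carrier V"
    by (auto simp: quotient_space_def A_RCOSETS_def')
  have add: "N +>\<^bsub>V\<^esub> (x \<oplus>\<^bsub>V\<^esub> y) = (N +>\<^bsub>V\<^esub> x) \<oplus>\<^bsub>quotient_space V N\<^esub> (N +>\<^bsub>V\<^esub> y)"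
    if "x \<in> carrier V" "y \<in> carrier V" for x y
    using N.a_rcos_sum[OF that] by (simp add: quotient_space_def)
  have smult: "N +>\<^bsub>V\<^esub> (a \<odot>\<^bsub>V\<^esub> x) = a \<odot>\<^bsub>quotient_space V N\<^esub> (N +>\<^bsub>V\<^esub> x)"
    if a: "a \<in> carrier K" and x: "x \<in> carrier V" for a x
  proof -
    have const: "N +>\<^bsub>V\<^esub> (a \<odot>\<^bsub>V\<^esub> y) = N +>\<^bsub>V\<^esub> (a \<odot>\<^bsub>V\<^esub> x)" if y: "y \<in> N +>\<^bsub>V\<^esub> x" for y
    proof -
      obtain n where n: "n \<in> N" "y = n \<oplus>\<^bsub>V\<^esub> x" using y by (auto simp: a_r_coset_def')
      have nV: "n \<in> carrier V" using n(1) NE(1) by auto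
      have "a \<odot>\<^bsub>V\<^esub> y \<in> N +>\<^bsub>V\<^esub> (a \<odot>\<^bsub>V\<^esub> x)"
        using n NE(4)[OF a n(1)] V.smult_r_distr[OF a nV x] by (auto simp: a_r_coset_def')
      then show ?thesis
        using N.a_repr_independence'[of "a \<odot>\<^bsub>V\<^esub> y" "a \<odot>\<^bsub>V\<^esub> x"] V.smult_closed[OF a x] by simp
    qed
    have "(\<Union>y\<in>N +>\<^bsub>V\<^esub> x. N +>\<^bsub>V\<^esub> (a \<odot>\<^bsub>V\<^esub> y)) = N +>\<^bsub>V\<^esub> (a \<odot>\<^bsub>V\<^esub> x)"
      using N.a_rcos_self[OF x] const by (intro UN_constant_eq ballI)
    then show ?thesis by (simp add: quotient_space_def)
  qed
  have null: "N +>\<^bsub>V\<^esub> x = \<zero>\<^bsub>quotient_space V N\<^esub>" if "x \<in> N" for x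
    using that NE(1) N.a_rcos_const by (simp add: quotient_space_def)
  then show "x \<in> N \<Longrightarrow> N +>\<^bsub>V\<^esub> x = \<zero>\<^bsub>quotient_space V N\<^esub>" .
  show "is_linear K V (quotient_space V N) (\<lambda>x. N +>\<^bsub>V\<^esub> x)"
    by (rule is_linearI) (use car add smult in auto)
  show "module K (quotient_space V N)"
    by (rule module_image[OF assms(1) car[symmetric]]) (use null add smult in auto)
qed

section \<open>The universal property of the tensor product\<close>

\<comment> \<open>The free space serves only as an abstract module with generators from here on.\<close>
declare free_space_simps [simp del]

definition bilinear ::
  "('k, 'r) ring_scheme \<Rightarrow> ('k, 'v, 'x) module_scheme \<Rightarrow> ('k, 'w, 'y) module_scheme
    \<Rightarrow> ('k, 'u, 'z) module_scheme \<Rightarrow> ('v \<Rightarrow> 'w \<Rightarrow> 'u) \<Rightarrow> bool"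
  where "bilinear K V W U f \<longleftrightarrow>
    (\<forall>w\<in>carrier W. is_linear K V U (\<lambda>v. f v w)) \<and> (\<forall>v\<in>carrier V. is_linear K W U (\<lambda>w. f v w))"

lemma bilinearI:
  assumes "\<And>w. w \<in> carrier W \<Longrightarrow> is_linear K V U (\<lambda>v. f v w)"
    and "\<And>v. v \<in> carrier V \<Longrightarrow> is_linear K W U (\<lambda>w. f v w)"
  shows "bilinear K V W U f"
  using assms by (simp add: bilinear_def)

lemma bilinearD:
  assumes "bilinear K V W U f"
  shows "w \<in> carrier W \<Longrightarrow> is_linear K V U (\<lambda>v. f v w)"
    and "v \<in> carrier V \<Longrightarrow> is_linear K W U (\<lambda>w. f v w)"
    and "v \<in> carrier V \<Longrightarrow> w \<in> carrier W \<Longrightarrow> f v w \<in> carrier U"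
  using assms is_linearD(1) by (fastforce simp: bilinear_def)+

lemma submodule_kernel:
  assumes "module K V" "module K U" "is_linear K V U h"
  shows "submodule {x \<in> carrier V. h x = \<zero>\<^bsub>U\<^esub>} K V"
proof -
  interpret V: module K V by fact
  interpret U: module K U by fact
  note h = is_linearD[OF assms(3)]
  have minus: "h (\<ominus>\<^bsub>V\<^esub> x) = \<zero>\<^bsub>U\<^esub>" if "x \<in> carrier V" "h x = \<zero>\<^bsub>U\<^esub>" for x
  proof -
    have "h (\<ominus>\<^bsub>V\<^esub> x) = h ((\<ominus>\<^bsub>K\<^esub> \<one>\<^bsub>K\<^esub>) \<odot>\<^bsub>V\<^esub> x)" using that by (simp add: V.smult_l_minus)
    also have "\<dots> = \<zero>\<^bsub>U\<^esub>" using that h(3)[of "\<ominus>\<^bsub>K\<^esub> \<one>\<^bsub>K\<^esub>" x] by simp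
    finally show ?thesis .
  qed
  show ?thesis
    by (rule V.submoduleI) (simp_all add: minus h is_linear_zero[OF assms])
qed

lemma
  assumes "module K V" "module K W"
  defines "P \<equiv> free_space K (carrier V \<times> carrier W)"
  shows module_tensor: "module K (tensor K V W)"
    and tensor_class_linear: "is_linear K P (tensor K V W) (\<lambda>x. tensor_null K V W +>\<^bsub>P\<^esub> x)"
    and tensor_carrier: "carrier (tensor K V W) = (\<lambda>x. tensor_null K V W +>\<^bsub>P\<^esub> x) ` carrier P"
    and tensor_class_null: "x \<in> tensor_null K V W \<Longrightarrow> tensor_null K V W +>\<^bsub>P\<^esub> x = \<zero>\<^bsub>tensor K V W\<^esub>"
    and tensor_relations_null: "tensor_relations K V W \<subseteq> tensor_null K V W"
    and submodule_tensor_null: "submodule (tensor_null K V W) K P"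
    and tensor_null_least: "submodule N K P \<Longrightarrow> tensor_relations K V W \<subseteq> N \<Longrightarrow> tensor_null K V W \<subseteq> N"
proof -
  interpret V: module K V by fact
  interpret W: module K W by fact
  have P: "module K P" unfolding P_def by (rule module_free_space) (rule V.R.cring_axioms)
  interpret P: module K P by fact
  have e: "free_gen K (v, w) \<in> carrier P" if "v \<in> carrier V" "w \<in> carrier W" for v w
    unfolding P_def using that by (intro free_gen_closed V.R.cring_axioms) auto
  have rel: "tensor_relations K V W \<subseteq> carrier P"
    unfolding tensor_relations_def Let_def P_def[symmetric] by (auto intro!: e)
  note S = submodule_span[OF P rel, folded tensor_null_def[of K V W, folded P_def]]
  show "submodule (tensor_null K V W) K P" "tensor_relations K V W \<subseteq> tensor_null K V W"
    "submodule N K P \<Longrightarrow> tensor_relations K V W \<subseteq> N \<Longrightarrow> tensor_null K V W \<subseteq> N"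
    using S by auto
  note Q = quotient_space_props[OF P S(1), folded tensor_def[of K V W, folded P_def]]
  show "module K (tensor K V W)"
    "is_linear K P (tensor K V W) (\<lambda>x. tensor_null K V W +>\<^bsub>P\<^esub> x)"
    "carrier (tensor K V W) = (\<lambda>x. tensor_null K V W +>\<^bsub>P\<^esub> x) ` carrier P"
    "x \<in> tensor_null K V W \<Longrightarrow> tensor_null K V W +>\<^bsub>P\<^esub> x = \<zero>\<^bsub>tensor K V W\<^esub>"
    using Q by auto
qed

text \<open>
  Each bilinearity equation is the statement that a relation of the tensor product vanishes in the
  quotient.
\<close>

lemma tensor_pure_bilinear:
  assumes "module K V" "module K W"
  shows "bilinear K V W (tensor K V W) (tensor_pure K V W)"
proof -
  define P where "P = free_space K (carrier V \<times> carrier W)"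
  define \<pi> where "\<pi> = (\<lambda>x. tensor_null K V W +>\<^bsub>P\<^esub> x)"
  interpret V: module K V by fact
  interpret W: module K W by fact
  interpret P: module K P unfolding P_def by (rule module_free_space) (rule V.R.cring_axioms)
  interpret T: module K "tensor K V W" by (rule module_tensor) fact+
  have e [simp]: "free_gen K (v, w) \<in> carrier P" if "v \<in> carrier V" "w \<in> carrier W" for v w
    unfolding P_def using that by (intro free_gen_closed V.R.cring_axioms) auto
  have pure: "tensor_pure K V W v w = \<pi> (free_gen K (v, w))" for v w
    by (simp add: tensor_pure_def \<pi>_def P_def)
  have lin: "is_linear K P (tensor K V W) \<pi>"
    unfolding \<pi>_def P_def by (rule tensor_class_linear) fact+
  note lin = is_linearD[OF lin]
  have eq: "\<pi> x = \<pi> y"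
    if r: "x \<ominus>\<^bsub>P\<^esub> y \<in> tensor_relations K V W" and x: "x \<in> carrier P" and y: "y \<in> carrier P" for x y
  proof -
    have "x = (x \<ominus>\<^bsub>P\<^esub> y) \<oplus>\<^bsub>P\<^esub> y" using x y by (simp add: a_minus_def P.M.a_assoc P.M.l_neg)
    then have "\<pi> x = \<pi> (x \<ominus>\<^bsub>P\<^esub> y) \<oplus>\<^bsub>tensor K V W\<^esub> \<pi> y" using x y lin(2)[of "x \<ominus>\<^bsub>P\<^esub> y" y] by simp
    also have "\<pi> (x \<ominus>\<^bsub>P\<^esub> y) = \<zero>\<^bsub>tensor K V W\<^esub>"
      unfolding \<pi>_def P_def
      by (rule tensor_class_null[OF assms]) (use r tensor_relations_null[OF assms] P_def in auto)
    finally show ?thesis using y lin(1) by simp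
  qed
  note rel = tensor_relations_def[of K V W, unfolded Let_def, folded P_def]
  show ?thesis
  proof (intro bilinearI is_linearI)
    fix v w assume v: "v \<in> carrier V" and w: "w \<in> carrier W"
    show "tensor_pure K V W v w \<in> carrier (tensor K V W)"
      unfolding pure using v w by (simp add: lin(1))
    then show "tensor_pure K V W v w \<in> carrier (tensor K V W)" .
    fix a assume a: "a \<in> carrier K"
    show "tensor_pure K V W (a \<odot>\<^bsub>V\<^esub> v) w = a \<odot>\<^bsub>tensor K V W\<^esub> tensor_pure K V W v w"
      unfolding pure lin(3)[OF a e[OF v w], symmetric]
      by (rule eq, unfold rel, use v w a in blast) (use v w a in simp_all)
    show "tensor_pure K V W v (a \<odot>\<^bsub>W\<^esub> w) = a \<odot>\<^bsub>tensor K V W\<^esub> tensor_pure K V W v w"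
      unfolding pure lin(3)[OF a e[OF v w], symmetric]
      by (rule eq, unfold rel, use v w a in blast) (use v w a in simp_all)
  next
    fix v v' w assume v: "v \<in> carrier V" "v' \<in> carrier V" and w: "w \<in> carrier W"
    show "tensor_pure K V W (v \<oplus>\<^bsub>V\<^esub> v') w =
        tensor_pure K V W v w \<oplus>\<^bsub>tensor K V W\<^esub> tensor_pure K V W v' w"
      unfolding pure lin(2)[OF e[OF v(1) w] e[OF v(2) w], symmetric]
      by (rule eq, unfold rel, use v w in blast) (use v w in simp_all)
  next
    fix v w w' assume v: "v \<in> carrier V" and w: "w \<in> carrier W" "w' \<in> carrier W"
    show "tensor_pure K V W v (w \<oplus>\<^bsub>W\<^esub> w') =
        tensor_pure K V W v w \<oplus>\<^bsub>tensor K V W\<^esub> tensor_pure K V W v w'"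
      unfolding pure lin(2)[OF e[OF v w(1)] e[OF v w(2)], symmetric]
      by (rule eq, unfold rel, use v w in blast) (use v w in simp_all)
  qed
qed

text \<open>
  The linear extension of a bilinear map to formal combinations of pairs kills the relations, so
  it is constant on each coset, and \<^const>\<open>the_elem\<close> in the definition of \<^const>\<open>tensor_lift\<close> is
  applied to a singleton.
\<close>

lemma tensor_lift_class:
  assumes "module K V" "module K W" "module K U" and f: "bilinear K V W U f"
    and x: "x \<in> carrier (free_space K (carrier V \<times> carrier W))"
  shows "tensor_lift K V W U f
      (tensor_null K V W +>\<^bsub>free_space K (carrier V \<times> carrier W)\<^esub> x) =
    lin_ext K U (\<lambda>p. f (fst p) (snd p)) x"
proof -
  define P where "P = free_space K (carrier V \<times> carrier W)"
  define L where "L = lin_ext K U (\<lambda>p. f (fst p) (snd p))"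
  interpret V: module K V by fact
  interpret W: module K W by fact
  interpret U: module K U by fact
  interpret P: module K P unfolding P_def by (rule module_free_space) (rule V.R.cring_axioms)
  have e [simp]: "free_gen K (v, w) \<in> carrier P" if "v \<in> carrier V" "w \<in> carrier W" for v w
    unfolding P_def using that by (intro free_gen_closed V.R.cring_axioms) auto
  have f1: "f v w \<in> carrier U" if "v \<in> carrier V" "w \<in> carrier W" for v w
    using bilinearD(3)[OF f that] .
  note f2 = is_linearD(2,3)[OF bilinearD(1)[OF f]] is_linearD(2,3)[OF bilinearD(2)[OF f]]
  have L: "is_linear K P U L" unfolding L_def P_def
    by (rule lin_ext_linear[OF assms(3)]) (use f1 in auto)
  note LD = is_linearD[OF L]
  have Lgen: "L (free_gen K (v, w)) = f v w" if "v \<in> carrier V" "w \<in> carrier W" for v w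
    unfolding L_def using lin_ext_gen[OF assms(3), of "\<lambda>p. f (fst p) (snd p)" "(v, w)"] f1 that by simp
  have Lminus: "L (\<ominus>\<^bsub>P\<^esub> z) = \<ominus>\<^bsub>U\<^esub> L z" if "z \<in> carrier P" for z
    using that LD(1) LD(3)[of "\<ominus>\<^bsub>K\<^esub> \<one>\<^bsub>K\<^esub>" z] by (simp add: P.smult_l_minus U.smult_l_minus)
  have Lrel: "L (y \<ominus>\<^bsub>P\<^esub> z) = \<zero>\<^bsub>U\<^esub>" if "y \<in> carrier P" "z \<in> carrier P" "L y = L z" for y z
    using that LD(1) by (simp add: a_minus_def LD(2) Lminus U.M.r_neg)
  have "tensor_relations K V W \<subseteq> {x \<in> carrier P. L x = \<zero>\<^bsub>U\<^esub>}"
    unfolding tensor_relations_def Let_def P_def[symmetric]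
    by (auto intro!: Lrel simp: Lgen LD(2,3) f2)
  then have null: "tensor_null K V W \<subseteq> {x \<in> carrier P. L x = \<zero>\<^bsub>U\<^esub>}"
    unfolding P_def
    by (intro tensor_null_least[OF assms(1,2)] submodule_kernel[OF _ assms(3)])
      (use P.module_axioms L in \<open>auto simp: P_def\<close>)
  have "L ` (tensor_null K V W +>\<^bsub>P\<^esub> x) = {L x}"
  proof (intro equalityI subsetI)
    fix u assume "u \<in> L ` (tensor_null K V W +>\<^bsub>P\<^esub> x)"
    then obtain n where "n \<in> tensor_null K V W" "u = L (n \<oplus>\<^bsub>P\<^esub> x)" by (auto simp: a_r_coset_def')
    then show "u \<in> {L x}" using null x LD(1) LD(2)[of n x] by (auto simp flip: P_def)
  next
    have "\<zero>\<^bsub>P\<^esub> \<in> tensor_null K V W"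
      using subgroup.one_closed[OF submodule.axioms(1)[OF submodule_tensor_null[OF assms(1,2)]]]
      by (simp add: P_def)
    moreover have "x = \<zero>\<^bsub>P\<^esub> \<oplus>\<^bsub>P\<^esub> x" using x by (simp flip: P_def)
    ultimately have "x \<in> tensor_null K V W +>\<^bsub>P\<^esub> x" unfolding a_r_coset_def' by blast
    then show "u \<in> {L x} \<Longrightarrow> u \<in> L ` (tensor_null K V W +>\<^bsub>P\<^esub> x)" for u by simp
  qed
  moreover have "tensor_null K V W +>\<^bsub>P\<^esub> x \<in> carrier (tensor K V W)"
    unfolding tensor_carrier[OF assms(1,2)] P_def using x by simp
  ultimately show ?thesis
    by (simp add: tensor_lift_def L_def lin_ext_def flip: P_def)
qed

lemma tensor_lift_linear:
  assumes "module K V" "module K W" "module K U" "bilinear K V W U f"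
  shows "is_linear K (tensor K V W) U (tensor_lift K V W U f)"
proof -
  define P where "P = free_space K (carrier V \<times> carrier W)"
  interpret V: module K V by fact
  interpret P: module K P unfolding P_def by (rule module_free_space) (rule V.R.cring_axioms)
  note cls = tensor_lift_class[OF assms, folded P_def]
  note \<pi> = is_linearD(2,3)[OF tensor_class_linear[OF assms(1,2)], folded P_def]
  have "is_linear K P U (lin_ext K U (\<lambda>p. f (fst p) (snd p)))"
    unfolding P_def using bilinearD(3)[OF assms(4)] by (intro lin_ext_linear assms) auto
  note L = is_linearD[OF this]
  show ?thesis
    by (rule is_linearI, unfold tensor_carrier[OF assms(1,2), folded P_def])
      (auto simp: cls L simp flip: \<pi>)
qed

lemma tensor_lift_pure:
  assumes "module K V" "module K W" "module K U" "bilinear K V W U f"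
    and "v \<in> carrier V" "w \<in> carrier W"
  shows "tensor_lift K V W U f (tensor_pure K V W v w) = f v w"
proof -
  interpret V: module K V by fact
  show ?thesis unfolding tensor_pure_def
    using assms bilinearD(3)[OF assms(4-6)]
    by (subst tensor_lift_class) (auto simp: lin_ext_gen intro!: free_gen_closed V.R.cring_axioms)
qed

text \<open>
  The formal combinations on which the two maps differ by zero form a submodule; it contains the
  generators, whose classes are the pure tensors, so it is everything.
\<close>

lemma tensor_linear_eqI:
  assumes "module K V" "module K W" "module K U"
    and g: "is_linear K (tensor K V W) U g" and h: "is_linear K (tensor K V W) U h"
    and pure: "\<And>v w. \<lbrakk>v \<in> carrier V; w \<in> carrier W\<rbrakk> \<Longrightarrow>
      g (tensor_pure K V W v w) = h (tensor_pure K V W v w)"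
    and t: "t \<in> carrier (tensor K V W)"
  shows "g t = h t"
proof -
  define P where "P = free_space K (carrier V \<times> carrier W)"
  define \<pi> where "\<pi> = (\<lambda>x. tensor_null K V W +>\<^bsub>P\<^esub> x)"
  interpret V: module K V by fact
  interpret U: module K U by fact
  interpret P: module K P unfolding P_def by (rule module_free_space) (rule V.R.cring_axioms)
  have \<pi>: "is_linear K P (tensor K V W) \<pi>"
    unfolding \<pi>_def P_def by (rule tensor_class_linear) fact+
  define d where "d = (\<lambda>x. g (\<pi> x) \<oplus>\<^bsub>U\<^esub> (\<ominus>\<^bsub>K\<^esub> \<one>\<^bsub>K\<^esub>) \<odot>\<^bsub>U\<^esub> h (\<pi> x))"
  have d: "is_linear K P U d" unfolding d_def
    by (intro is_linear_add is_linear_smult is_linear_compose[OF g] is_linear_compose[OF h]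
        assms \<pi>) simp
  have N: "submodule {x \<in> carrier P. d x = \<zero>\<^bsub>U\<^esub>} K P"
    by (rule submodule_kernel[OF P.module_axioms assms(3) d])
  have val: "g (\<pi> x) \<in> carrier U" "h (\<pi> x) \<in> carrier U" if "x \<in> carrier P" for x
    using that is_linearD(1)[OF is_linear_compose[OF g \<pi>]] is_linearD(1)[OF is_linear_compose[OF h \<pi>]]
    by auto
  have zero: "d x = \<zero>\<^bsub>U\<^esub> \<longleftrightarrow> g (\<pi> x) = h (\<pi> x)" if "x \<in> carrier P" for x
    unfolding d_def using val[OF that]
    by (simp add: U.smult_l_minus U.M.add.inv_solve_right')
  obtain x where x: "x \<in> carrier P" "t = \<pi> x"
    using t unfolding tensor_carrier[OF assms(1,2)] \<pi>_def P_def by auto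
  have "x \<in> {x \<in> carrier P. d x = \<zero>\<^bsub>U\<^esub>}"
  proof (rule free_space_generated[OF V.R.cring_axioms N[unfolded P_def], folded P_def])
    fix p assume "p \<in> carrier V \<times> carrier W"
    then obtain v w where p: "p = (v, w)" "v \<in> carrier V" "w \<in> carrier W" by auto
    have "free_gen K p \<in> carrier P"
      unfolding P_def using p by (intro free_gen_closed V.R.cring_axioms) auto
    then show "free_gen K p \<in> {x \<in> carrier P. d x = \<zero>\<^bsub>U\<^esub>}"
      using pure[OF p(2,3)] p(1) by (simp add: zero) (simp add: tensor_pure_def \<pi>_def P_def)
  qed (fact x(1))
  then show ?thesis using zero x by simp
qed

lemma tensor_pure_closed [simp]:
  assumes "module K V" "module K W" "v \<in> carrier V" "w \<in> carrier W"
  shows "tensor_pure K V W v w \<in> carrier (tensor K V W)"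
  by (rule bilinearD(3)[OF tensor_pure_bilinear[OF assms(1,2)] assms(3,4)])

lemma is_linear_tensor_pure_left:
  assumes "module K V" "module K W" "w \<in> carrier W" "is_linear K X V f"
  shows "is_linear K X (tensor K V W) (\<lambda>x. tensor_pure K V W (f x) w)"
  by (rule is_linear_compose[OF bilinearD(1)[OF tensor_pure_bilinear[OF assms(1,2)] assms(3)] assms(4)])

lemma is_linear_tensor_pure_right:
  assumes "module K V" "module K W" "v \<in> carrier V" "is_linear K X W f"
  shows "is_linear K X (tensor K V W) (\<lambda>x. tensor_pure K V W v (f x))"
  by (rule is_linear_compose[OF bilinearD(2)[OF tensor_pure_bilinear[OF assms(1,2)] assms(3)] assms(4)])

lemma is_linear_tensor_lift:
  assumes "module K V" "module K W" "module K U" "bilinear K V W U f"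
    and "is_linear K X (tensor K V W) g"
  shows "is_linear K X U (\<lambda>x. tensor_lift K V W U f (g x))"
  by (rule is_linear_compose[OF tensor_lift_linear[OF assms(1-4)] assms(5)])

lemma bilinear_compose:
  assumes "is_linear K U U' h" "bilinear K V W U f"
  shows "bilinear K V W U' (\<lambda>v w. h (f v w))"
  by (intro bilinearI is_linear_compose[OF assms(1)] bilinearD(1,2)[OF assms(2)])

lemma tensor_lift_cong:
  assumes "module K V" "module K W" "module K U" "bilinear K V W U f"
    and eq: "\<And>v w. \<lbrakk>v \<in> carrier V; w \<in> carrier W\<rbrakk> \<Longrightarrow> f v w = g v w"
    and t: "t \<in> carrier (tensor K V W)"
  shows "tensor_lift K V W U f t = tensor_lift K V W U g t"
proof -
  have g: "bilinear K V W U g"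
    using is_linear_cong[OF assms(1) bilinearD(1)[OF assms(4)]]
      is_linear_cong[OF assms(2) bilinearD(2)[OF assms(4)]] eq
    by (simp add: bilinear_def)
  show ?thesis
    by (rule tensor_linear_eqI[OF assms(1-3) _ _ _ t])
      (simp_all add: tensor_lift_linear tensor_lift_pure assms g eq)
qed

lemma linear_tensor_lift:
  assumes "module K V" "module K W" "module K U" "module K U'"
    and f: "bilinear K V W U f" and h: "is_linear K U U' h" and t: "t \<in> carrier (tensor K V W)"
  shows "h (tensor_lift K V W U f t) = tensor_lift K V W U' (\<lambda>v w. h (f v w)) t"
  by (rule tensor_linear_eqI[OF assms(1,2,4) _ _ _ t])
    (simp_all add: is_linear_compose[OF h] tensor_lift_linear tensor_lift_pure assms
      bilinear_compose[OF h f])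

text \<open>
  Here the bilinear map varies with \<open>x\<close> and the tensor \<open>t\<close> is fixed. Each linearity equation is an
  equation between linear functions of \<open>t\<close>, so it may be checked on pure tensors.
\<close>

lemma is_linear_tensor_lift_param:
  assumes "module K V" "module K W" "module K U" "module K X"
    and t: "t \<in> carrier (tensor K V W)"
    and lin: "\<And>v w. \<lbrakk>v \<in> carrier V; w \<in> carrier W\<rbrakk> \<Longrightarrow> is_linear K X U (\<lambda>x. f x v w)"
    and bil: "\<And>x. x \<in> carrier X \<Longrightarrow> bilinear K V W U (f x)"
  shows "is_linear K X U (\<lambda>x. tensor_lift K V W U (f x) t)"
proof -
  interpret X: module K X by fact
  note L = tensor_lift_linear[OF assms(1-3)] and LP = tensor_lift_pure[OF assms(1-3)]
  show ?thesis
  proof (rule is_linearI)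
    fix x assume x: "x \<in> carrier X"
    show "tensor_lift K V W U (f x) t \<in> carrier U" using is_linearD(1)[OF L[OF bil[OF x]] t] .
    show "tensor_lift K V W U (f (a \<odot>\<^bsub>X\<^esub> x)) t = a \<odot>\<^bsub>U\<^esub> tensor_lift K V W U (f x) t"
      if a: "a \<in> carrier K" for a
      by (rule tensor_linear_eqI[OF assms(1-3) _ _ _ t])
        (use x a in \<open>simp_all add: L LP bil is_linear_smult assms is_linearD(3)[OF lin]\<close>)
    fix y assume y: "y \<in> carrier X"
    show "tensor_lift K V W U (f (x \<oplus>\<^bsub>X\<^esub> y)) t =
        tensor_lift K V W U (f x) t \<oplus>\<^bsub>U\<^esub> tensor_lift K V W U (f y) t"
      by (rule tensor_linear_eqI[OF assms(1-3) _ _ _ t])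
        (use x y in \<open>simp_all add: L LP bil is_linear_add assms is_linearD(2)[OF lin]\<close>)
  qed
qed

text \<open>
  This is the exchange of two finite sums. Both sides are linear in \<open>t\<close>, and for a pure \<open>t\<close> each is
  the lift over \<open>s\<close> alone.
\<close>

lemma tensor_lift_swap:
  assumes "module K A" "module K B" "module K X" "module K Y" "module K U"
    and t: "t \<in> carrier (tensor K A B)" and s: "s \<in> carrier (tensor K X Y)"
    and bil1: "\<And>x y. \<lbrakk>x \<in> carrier X; y \<in> carrier Y\<rbrakk> \<Longrightarrow> bilinear K A B U (\<lambda>a b. g a b x y)"
    and bil2: "\<And>a b. \<lbrakk>a \<in> carrier A; b \<in> carrier B\<rbrakk> \<Longrightarrow> bilinear K X Y U (\<lambda>x y. g a b x y)"
  shows "tensor_lift K A B U (\<lambda>a b. tensor_lift K X Y U (\<lambda>x y. g a b x y) s) t =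
    tensor_lift K X Y U (\<lambda>x y. tensor_lift K A B U (\<lambda>a b. g a b x y) t) s"
proof -
  have bil: "bilinear K A B U (\<lambda>a b. tensor_lift K X Y U (\<lambda>x y. g a b x y) s)"
    by (intro bilinearI is_linear_tensor_lift_param assms s) (auto intro: bil2 bilinearD bil1)
  have bil': "bilinear K X Y U (\<lambda>x y. tensor_lift K A B U (\<lambda>a b. g a b x y) t)"
    if "t \<in> carrier (tensor K A B)" for t
    by (intro bilinearI is_linear_tensor_lift_param assms that) (auto intro: bil1 bilinearD bil2)
  have T: "module K (tensor K A B)" by (rule module_tensor) fact+
  have lin: "is_linear K (tensor K A B) U
      (\<lambda>t. tensor_lift K X Y U (\<lambda>x y. tensor_lift K A B U (\<lambda>a b. g a b x y) t) s)"
    by (rule is_linear_tensor_lift_param)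
      (simp_all add: assms T s tensor_lift_linear bil1 bil')
  show ?thesis
  proof (rule tensor_linear_eqI[OF assms(1,2,5) tensor_lift_linear lin _ t])
    fix a b assume ab: "a \<in> carrier A" "b \<in> carrier B"
    have p: "tensor_pure K A B a b \<in> carrier (tensor K A B)" by (simp add: assms ab)
    have "tensor_lift K X Y U (\<lambda>x y. tensor_lift K A B U (\<lambda>a b. g a b x y) (tensor_pure K A B a b)) s =
      tensor_lift K X Y U (\<lambda>x y. g a b x y) s"
      by (rule tensor_lift_cong) (simp_all add: assms s bil'[OF p] tensor_lift_pure bil1 ab)
    then show "tensor_lift K A B U (\<lambda>a b. tensor_lift K X Y U (\<lambda>x y. g a b x y) s)
          (tensor_pure K A B a b) =
        tensor_lift K X Y U (\<lambda>x y. tensor_lift K A B U (\<lambda>a b. g a b x y) (tensor_pure K A B a b)) s"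
      by (simp add: tensor_lift_pure assms bil ab)
  qed (use assms bil in auto)
qed

lemma linear_maps_tensor_eqI:
  assumes "module K V" "module K W" "module K U"
    and "g \<in> linear_maps K (tensor K V W) U" "h \<in> linear_maps K (tensor K V W) U"
    and "\<And>v w. \<lbrakk>v \<in> carrier V; w \<in> carrier W\<rbrakk> \<Longrightarrow>
      g (tensor_pure K V W v w) = h (tensor_pure K V W v w)"
  shows "g = h"
  using assms tensor_linear_eqI[OF assms(1-3), of g h]
  by (intro extensionalityI[of _ "carrier (tensor K V W)"]) (auto simp: linear_maps_def)

lemma tensor_lift_linear_maps:
  assumes "module K V" "module K W" "module K U" "bilinear K V W U f"
  shows "tensor_lift K V W U f \<in> linear_maps K (tensor K V W) U"
  using tensor_lift_linear[OF assms] by (simp add: linear_maps_def tensor_lift_def)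

lemma
  assumes "module K V" "module K W" "module K V'" "module K W'"
    and f: "is_linear K V V' f" and g: "is_linear K W W' g"
  shows tensor_map_linear:
      "is_linear K (tensor K V W) (tensor K V' W') (tensor_map K V W V' W' f g)"
    and tensor_map_pure: "\<lbrakk>v \<in> carrier V; w \<in> carrier W\<rbrakk> \<Longrightarrow>
      tensor_map K V W V' W' f g (tensor_pure K V W v w) = tensor_pure K V' W' (f v) (g w)"
proof -
  have "bilinear K V W (tensor K V' W') (\<lambda>v w. tensor_pure K V' W' (f v) (g w))"
    by (intro bilinearI is_linear_tensor_pure_left is_linear_tensor_pure_right assms
        is_linearD(1)[OF f] is_linearD(1)[OF g])
  then show "is_linear K (tensor K V W) (tensor K V' W') (tensor_map K V W V' W' f g)"
    "\<lbrakk>v \<in> carrier V; w \<in> carrier W\<rbrakk> \<Longrightarrow>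
      tensor_map K V W V' W' f g (tensor_pure K V W v w) = tensor_pure K V' W' (f v) (g w)"
    unfolding tensor_map_def
    by (simp_all add: tensor_lift_linear tensor_lift_pure assms module_tensor)
qed

lemma
  assumes "module K V" "module K W"
  shows tensor_flip_linear: "is_linear K (tensor K V W) (tensor K W V) (tensor_flip K V W)"
    and tensor_flip_pure: "\<lbrakk>v \<in> carrier V; w \<in> carrier W\<rbrakk> \<Longrightarrow>
      tensor_flip K V W (tensor_pure K V W v w) = tensor_pure K W V w v"
proof -
  have "bilinear K V W (tensor K W V) (\<lambda>v w. tensor_pure K W V w v)"
    by (intro bilinearI is_linear_tensor_pure_left is_linear_tensor_pure_right assms is_linear_id)
  then show "is_linear K (tensor K V W) (tensor K W V) (tensor_flip K V W)"
    "\<lbrakk>v \<in> carrier V; w \<in> carrier W\<rbrakk> \<Longrightarrow>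
      tensor_flip K V W (tensor_pure K V W v w) = tensor_pure K W V w v"
    unfolding tensor_flip_def
    by (simp_all add: tensor_lift_linear tensor_lift_pure assms module_tensor)
qed

text \<open>
  The formula is stated for an arbitrary \<open>t\<close> in \<open>U \<otimes> V\<close>, not only for a pure one: the coactions
  apply it to values of the comultiplication.
\<close>

lemma
  assumes "module K U" "module K V" "module K W"
  shows tensor_assoc_linear:
      "is_linear K (tensor K (tensor K U V) W) (tensor K U (tensor K V W)) (tensor_assoc K U V W)"
    and tensor_assoc_pure: "\<lbrakk>t \<in> carrier (tensor K U V); w \<in> carrier W\<rbrakk> \<Longrightarrow>
      tensor_assoc K U V W (tensor_pure K (tensor K U V) W t w) =
      tensor_lift K U V (tensor K U (tensor K V W))
        (\<lambda>u v. tensor_pure K U (tensor K V W) u (tensor_pure K V W v w)) t"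
proof -
  have b: "bilinear K U V (tensor K U (tensor K V W))
      (\<lambda>u v. tensor_pure K U (tensor K V W) u (tensor_pure K V W v w))" if "w \<in> carrier W" for w
    using that by (intro bilinearI is_linear_tensor_pure_left is_linear_tensor_pure_right assms
        is_linear_id module_tensor tensor_pure_closed)
  have "bilinear K (tensor K U V) W (tensor K U (tensor K V W))
      (\<lambda>t w. tensor_lift K U V (tensor K U (tensor K V W))
        (\<lambda>u v. tensor_pure K U (tensor K V W) u (tensor_pure K V W v w)) t)"
    by (intro bilinearI is_linear_tensor_lift_param is_linear_tensor_lift is_linear_id b assms
        module_tensor is_linear_tensor_pure_right)
  then show "is_linear K (tensor K (tensor K U V) W) (tensor K U (tensor K V W)) (tensor_assoc K U V W)"
    "\<lbrakk>t \<in> carrier (tensor K U V); w \<in> carrier W\<rbrakk> \<Longrightarrow>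
      tensor_assoc K U V W (tensor_pure K (tensor K U V) W t w) =
      tensor_lift K U V (tensor K U (tensor K V W))
        (\<lambda>u v. tensor_pure K U (tensor K V W) u (tensor_pure K V W v w)) t"
    unfolding tensor_assoc_def
    by (simp_all add: tensor_lift_linear tensor_lift_pure assms module_tensor)
qed

lemma
  assumes "module K U" "module K V" "module K W"
  shows tensor_assoc_inv_linear:
      "is_linear K (tensor K U (tensor K V W)) (tensor K (tensor K U V) W) (tensor_assoc_inv K U V W)"
    and tensor_assoc_inv_pure: "\<lbrakk>u \<in> carrier U; t \<in> carrier (tensor K V W)\<rbrakk> \<Longrightarrow>
      tensor_assoc_inv K U V W (tensor_pure K U (tensor K V W) u t) =
      tensor_lift K V W (tensor K (tensor K U V) W)
        (\<lambda>v w. tensor_pure K (tensor K U V) W (tensor_pure K U V u v) w) t"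
proof -
  have b: "bilinear K V W (tensor K (tensor K U V) W)
      (\<lambda>v w. tensor_pure K (tensor K U V) W (tensor_pure K U V u v) w)" if "u \<in> carrier U" for u
    using that by (intro bilinearI is_linear_tensor_pure_left is_linear_tensor_pure_right assms
        is_linear_id module_tensor tensor_pure_closed)
  have "bilinear K U (tensor K V W) (tensor K (tensor K U V) W)
      (\<lambda>u t. tensor_lift K V W (tensor K (tensor K U V) W)
        (\<lambda>v w. tensor_pure K (tensor K U V) W (tensor_pure K U V u v) w) t)"
    by (intro bilinearI is_linear_tensor_lift_param is_linear_tensor_lift is_linear_id b assms
        module_tensor is_linear_tensor_pure_left)
  then show "is_linear K (tensor K U (tensor K V W)) (tensor K (tensor K U V) W) (tensor_assoc_inv K U V W)"
    "\<lbrakk>u \<in> carrier U; t \<in> carrier (tensor K V W)\<rbrakk> \<Longrightarrow>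
      tensor_assoc_inv K U V W (tensor_pure K U (tensor K V W) u t) =
      tensor_lift K V W (tensor K (tensor K U V) W)
        (\<lambda>v w. tensor_pure K (tensor K U V) W (tensor_pure K U V u v) w) t"
    unfolding tensor_assoc_inv_def
    by (simp_all add: tensor_lift_linear tensor_lift_pure assms module_tensor)
qed

text \<open>
  The dependence of \<open>f \<otimes> g\<close> on \<open>f\<close> and \<open>g\<close>, for use in the closure of the colinear maps under the
  operations of an algebra. Sums are restricted to the carrier as those operations demand.
\<close>

lemma tensor_map_add_left:
  assumes "module K V" "module K W" "module K V'" "module K W'"
    and f: "is_linear K V V' f" "is_linear K V V' f'" and g: "is_linear K W W' g"
    and t: "t \<in> carrier (tensor K V W)"
  shows "tensor_map K V W V' W' (\<lambda>x\<in>carrier V. f x \<oplus>\<^bsub>V'\<^esub> f' x) g t =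
    tensor_map K V W V' W' f g t \<oplus>\<^bsub>tensor K V' W'\<^esub> tensor_map K V W V' W' f' g t"
proof -
  note s = is_linear_restrict[OF assms(1) is_linear_add[OF assms(3) f]]
  show ?thesis
    by (rule tensor_linear_eqI[OF assms(1,2) module_tensor[OF assms(3,4)]
          tensor_map_linear[OF assms(1-4) s g] is_linear_add[OF module_tensor[OF assms(3,4)]
            tensor_map_linear[OF assms(1-4) f(1) g] tensor_map_linear[OF assms(1-4) f(2) g]] _ t])
      (simp add: tensor_map_pure[OF assms(1-4)] s f g is_linearD(1)[OF f(1)] is_linearD(1)[OF f(2)]
        is_linearD(2)[OF bilinearD(1)[OF tensor_pure_bilinear[OF assms(3,4)] is_linearD(1)[OF g]]])
qed

lemma tensor_map_add_right:
  assumes "module K V" "module K W" "module K V'" "module K W'"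
    and f: "is_linear K V V' f" and g: "is_linear K W W' g" "is_linear K W W' g'"
    and t: "t \<in> carrier (tensor K V W)"
  shows "tensor_map K V W V' W' f (\<lambda>x\<in>carrier W. g x \<oplus>\<^bsub>W'\<^esub> g' x) t =
    tensor_map K V W V' W' f g t \<oplus>\<^bsub>tensor K V' W'\<^esub> tensor_map K V W V' W' f g' t"
proof -
  note s = is_linear_restrict[OF assms(2) is_linear_add[OF assms(4) g]]
  show ?thesis
    by (rule tensor_linear_eqI[OF assms(1,2) module_tensor[OF assms(3,4)]
          tensor_map_linear[OF assms(1-4) f s] is_linear_add[OF module_tensor[OF assms(3,4)]
            tensor_map_linear[OF assms(1-4) f g(1)] tensor_map_linear[OF assms(1-4) f g(2)]] _ t])
      (simp add: tensor_map_pure[OF assms(1-4)] s f g is_linearD(1)[OF g(1)] is_linearD(1)[OF g(2)]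
        is_linearD(2)[OF bilinearD(2)[OF tensor_pure_bilinear[OF assms(3,4)] is_linearD(1)[OF f]]])
qed

lemma tensor_map_smult_left:
  assumes "module K V" "module K W" "module K V'" "module K W'"
    and f: "is_linear K V V' f" and g: "is_linear K W W' g"
    and a: "a \<in> carrier K" and t: "t \<in> carrier (tensor K V W)"
  shows "tensor_map K V W V' W' (\<lambda>x\<in>carrier V. a \<odot>\<^bsub>V'\<^esub> f x) g t =
    a \<odot>\<^bsub>tensor K V' W'\<^esub> tensor_map K V W V' W' f g t"
proof -
  note s = is_linear_restrict[OF assms(1) is_linear_smult[OF assms(3) f a]]
  show ?thesis
    by (rule tensor_linear_eqI[OF assms(1,2) module_tensor[OF assms(3,4)]
          tensor_map_linear[OF assms(1-4) s g] is_linear_smult[OF module_tensor[OF assms(3,4)]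
            tensor_map_linear[OF assms(1-4) f g] a] _ t])
      (simp add: tensor_map_pure[OF assms(1-4)] s f g a is_linearD(1)[OF f]
        is_linearD(3)[OF bilinearD(1)[OF tensor_pure_bilinear[OF assms(3,4)] is_linearD(1)[OF g]]])
qed

lemma tensor_map_smult_right:
  assumes "module K V" "module K W" "module K V'" "module K W'"
    and f: "is_linear K V V' f" and g: "is_linear K W W' g"
    and a: "a \<in> carrier K" and t: "t \<in> carrier (tensor K V W)"
  shows "tensor_map K V W V' W' f (\<lambda>x\<in>carrier W. a \<odot>\<^bsub>W'\<^esub> g x) t =
    a \<odot>\<^bsub>tensor K V' W'\<^esub> tensor_map K V W V' W' f g t"
proof -
  note s = is_linear_restrict[OF assms(2) is_linear_smult[OF assms(4) g a]]
  show ?thesis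
    by (rule tensor_linear_eqI[OF assms(1,2) module_tensor[OF assms(3,4)]
          tensor_map_linear[OF assms(1-4) f s] is_linear_smult[OF module_tensor[OF assms(3,4)]
            tensor_map_linear[OF assms(1-4) f g] a] _ t])
      (simp add: tensor_map_pure[OF assms(1-4)] s f g a is_linearD(1)[OF g]
        is_linearD(3)[OF bilinearD(2)[OF tensor_pure_bilinear[OF assms(3,4)] is_linearD(1)[OF f]]])
qed

text \<open>
  The composites enter as separate maps \<open>h\<close>, \<open>h'\<close> that are only compared on the carriers, which
  covers \<^const>\<open>compose\<close> as well as the identity.
\<close>

lemma tensor_map_compose:
  assumes "module K V" "module K W" "module K V'" "module K W'" "module K V''" "module K W''"
    and f: "is_linear K V V' f" and g: "is_linear K W W' g"
    and f': "is_linear K V' V'' f'" and g': "is_linear K W' W'' g'"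
    and h: "is_linear K V V'' h" "\<And>x. x \<in> carrier V \<Longrightarrow> h x = f' (f x)"
    and h': "is_linear K W W'' h'" "\<And>x. x \<in> carrier W \<Longrightarrow> h' x = g' (g x)"
    and t: "t \<in> carrier (tensor K V W)"
  shows "tensor_map K V W V'' W'' h h' t =
    tensor_map K V' W' V'' W'' f' g' (tensor_map K V W V' W' f g t)"
  by (rule tensor_linear_eqI[OF assms(1,2) module_tensor[OF assms(5,6)]
        tensor_map_linear[OF assms(1,2,5,6) h(1) h'(1)]
        is_linear_compose[OF tensor_map_linear[OF assms(3-6) f' g'] tensor_map_linear[OF assms(1-4) f g]]
        _ t])
    (simp add: tensor_map_pure assms is_linearD(1)[OF f] is_linearD(1)[OF g])

lemma tensor_map_id:
  assumes "module K V" "module K W"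
    and h: "is_linear K V V h" "\<And>x. x \<in> carrier V \<Longrightarrow> h x = x"
    and h': "is_linear K W W h'" "\<And>x. x \<in> carrier W \<Longrightarrow> h' x = x"
    and t: "t \<in> carrier (tensor K V W)"
  shows "tensor_map K V W V W h h' t = t"
  by (rule tensor_linear_eqI[OF assms(1,2) module_tensor[OF assms(1,2)]
        tensor_map_linear[OF assms(1,2,1,2) h(1) h'(1)] is_linear_id _ t])
    (simp add: tensor_map_pure assms)

section \<open>Sweedler sums\<close>

text \<open>
  The sum of \<open>f c\<^sub>(\<^sub>1\<^sub>) c\<^sub>(\<^sub>2\<^sub>)\<close>. Having \<open>c\<close> as an argument in its own right lets the rules below treat
  linearity in \<open>c\<close> and in parameters of \<open>f\<close> alike.
\<close>

definition sweedler ::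
  "('k, 'r) ring_scheme \<Rightarrow> ('k, 'c, 'x) coalgebra_scheme \<Rightarrow> ('k, 'u, 'z) module_scheme
    \<Rightarrow> ('c \<Rightarrow> 'c \<Rightarrow> 'u) \<Rightarrow> 'c \<Rightarrow> 'u"
  where "sweedler K C U f c = tensor_lift K C C U f (comul C c)"

context coalgebra
begin

lemma module_C: "module K C"
  by unfold_locales

lemma comul_closed: "c \<in> carrier C \<Longrightarrow> comul C c \<in> carrier (tensor K C C)"
  by (rule is_linearD(1)[OF comul_linear])

lemma is_linear_sweedler:
  assumes "module K U" "bilinear K C C U f" "is_linear K X C g"
  shows "is_linear K X U (\<lambda>x. sweedler K C U f (g x))"
  unfolding sweedler_def
  by (intro is_linear_tensor_lift is_linear_compose[OF comul_linear] module_C assms)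

lemma is_linear_sweedler_param:
  assumes "module K U" "module K X" "c \<in> carrier C"
    and "\<And>a b. \<lbrakk>a \<in> carrier C; b \<in> carrier C\<rbrakk> \<Longrightarrow> is_linear K X U (\<lambda>x. f x a b)"
    and "\<And>x. x \<in> carrier X \<Longrightarrow> bilinear K C C U (f x)"
  shows "is_linear K X U (\<lambda>x. sweedler K C U (f x) c)"
  unfolding sweedler_def
  by (intro is_linear_tensor_lift_param comul_closed module_C assms)

lemma sweedler_cong:
  assumes "module K U" "bilinear K C C U f" "c \<in> carrier C"
    and "\<And>a b. \<lbrakk>a \<in> carrier C; b \<in> carrier C\<rbrakk> \<Longrightarrow> f a b = g a b"
  shows "sweedler K C U f c = sweedler K C U g c"
  unfolding sweedler_def
  by (intro tensor_lift_cong comul_closed module_C assms)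

lemma linear_sweedler:
  assumes "module K U" "module K U'" "bilinear K C C U f" "is_linear K U U' h" "c \<in> carrier C"
  shows "h (sweedler K C U f c) = sweedler K C U' (\<lambda>a b. h (f a b)) c"
  unfolding sweedler_def
  by (intro linear_tensor_lift comul_closed module_C assms)

text \<open>
  Coassociativity in the form \<open>f(c\<^sub>(\<^sub>1\<^sub>)\<^sub>(\<^sub>1\<^sub>), c\<^sub>(\<^sub>1\<^sub>)\<^sub>(\<^sub>2\<^sub>), c\<^sub>(\<^sub>2\<^sub>)) = f(c\<^sub>(\<^sub>1\<^sub>), c\<^sub>(\<^sub>2\<^sub>)\<^sub>(\<^sub>1\<^sub>), c\<^sub>(\<^sub>2\<^sub>)\<^sub>(\<^sub>2\<^sub>))\<close> for
  trilinear \<open>f\<close>. The map \<open>f\<close> lifts to \<open>L\<close> on \<open>(C \<otimes> C) \<otimes> C\<close> and to \<open>R\<close> on \<open>C \<otimes> (C \<otimes> C)\<close>; the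
  reassociation carries \<open>R\<close> to \<open>L\<close>, and the two sides are \<open>L\<close> and \<open>R\<close> at the two iterated
  comultiplications of \<open>c\<close>.
\<close>

lemma sweedler_coassoc:
  assumes U: "module K U" and c: "c \<in> carrier C"
    and f1: "\<And>y z. \<lbrakk>y \<in> carrier C; z \<in> carrier C\<rbrakk> \<Longrightarrow> is_linear K C U (\<lambda>x. f x y z)"
    and f2: "\<And>x z. \<lbrakk>x \<in> carrier C; z \<in> carrier C\<rbrakk> \<Longrightarrow> is_linear K C U (\<lambda>y. f x y z)"
    and f3: "\<And>x y. \<lbrakk>x \<in> carrier C; y \<in> carrier C\<rbrakk> \<Longrightarrow> is_linear K C U (\<lambda>z. f x y z)"
  shows "sweedler K C U (\<lambda>a z. sweedler K C U (\<lambda>x y. f x y z) a) c =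
    sweedler K C U (\<lambda>x b. sweedler K C U (\<lambda>y z. f x y z) b) c"
proof -
  let ?CC = "tensor K C C"
  note C = module_C
  have CC: "module K ?CC" by (rule module_tensor[OF C C])
  have b12: "bilinear K C C U (\<lambda>x y. f x y z)" if "z \<in> carrier C" for z
    using that by (intro bilinearI f1 f2)
  have b23: "bilinear K C C U (\<lambda>y z. f x y z)" if "x \<in> carrier C" for x
    using that by (intro bilinearI f2 f3)
  define l where "l = (\<lambda>t z. tensor_lift K C C U (\<lambda>x y. f x y z) t)"
  define r where "r = (\<lambda>x t. tensor_lift K C C U (\<lambda>y z. f x y z) t)"
  have l: "bilinear K ?CC C U l" unfolding l_def
    by (intro bilinearI is_linear_tensor_lift_param is_linear_tensor_lift is_linear_id C U CC b12 f3)
  have r: "bilinear K C ?CC U r" unfolding r_def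
    by (intro bilinearI is_linear_tensor_lift_param is_linear_tensor_lift is_linear_id C U CC b23 f1)
  define L where "L = tensor_lift K ?CC C U l"
  define R where "R = tensor_lift K C ?CC U r"
  have L: "is_linear K (tensor K ?CC C) U L" and Lp: "\<And>t z. t \<in> carrier ?CC \<Longrightarrow> z \<in> carrier C \<Longrightarrow>
      L (tensor_pure K ?CC C t z) = l t z"
    unfolding L_def by (simp_all add: tensor_lift_linear tensor_lift_pure CC C U l)
  have R: "is_linear K (tensor K C ?CC) U R" and Rp: "\<And>x t. x \<in> carrier C \<Longrightarrow> t \<in> carrier ?CC \<Longrightarrow>
      R (tensor_pure K C ?CC x t) = r x t"
    unfolding R_def by (simp_all add: tensor_lift_linear tensor_lift_pure CC C U r)
  note as = tensor_assoc_linear[OF C C C]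
  have RL: "R (tensor_assoc K C C C s) = L s" if s: "s \<in> carrier (tensor K ?CC C)" for s
  proof (rule tensor_linear_eqI[OF CC C U is_linear_compose[OF R as] L _ s])
    fix t z assume t: "t \<in> carrier ?CC" and z: "z \<in> carrier C"
    have ass: "bilinear K C C (tensor K C ?CC)
        (\<lambda>u v. tensor_pure K C ?CC u (tensor_pure K C C v z))"
      using z by (intro bilinearI is_linear_tensor_pure_left is_linear_tensor_pure_right
          is_linear_id C CC tensor_pure_closed)
    have "R (tensor_assoc K C C C (tensor_pure K ?CC C t z)) =
        tensor_lift K C C U (\<lambda>u v. R (tensor_pure K C ?CC u (tensor_pure K C C v z))) t"
      unfolding tensor_assoc_pure[OF C C C t z]
      by (rule linear_tensor_lift[OF C C module_tensor[OF C CC] U ass R t])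
    also have "\<dots> = tensor_lift K C C U (\<lambda>u v. f u v z) t"
      by (rule tensor_lift_cong[OF C C U bilinear_compose[OF R ass] _ t])
        (simp add: Rp C z r_def tensor_lift_pure U b23)
    finally show "R (tensor_assoc K C C C (tensor_pure K ?CC C t z)) = L (tensor_pure K ?CC C t z)"
      by (simp add: Lp t z l_def)
  qed
  let ?m1 = "tensor_map K C C ?CC C (comul C) (\<lambda>x. x)"
  let ?m2 = "tensor_map K C C C ?CC (\<lambda>x. x) (comul C)"
  note m1 = tensor_map_linear[OF C C CC C comul_linear is_linear_id]
    and m2 = tensor_map_linear[OF C C C CC is_linear_id comul_linear]
  note m1p = tensor_map_pure[OF C C CC C comul_linear is_linear_id]
    and m2p = tensor_map_pure[OF C C C CC is_linear_id comul_linear]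
  have b1: "bilinear K C C U (\<lambda>a z. sweedler K C U (\<lambda>x y. f x y z) a)"
    by (intro bilinearI is_linear_sweedler is_linear_sweedler_param U C is_linear_id b12 f3)
  have b2: "bilinear K C C U (\<lambda>x b. sweedler K C U (\<lambda>y z. f x y z) b)"
    by (intro bilinearI is_linear_sweedler is_linear_sweedler_param U C is_linear_id b23 f1)
  have e1: "L (?m1 t) = tensor_lift K C C U (\<lambda>a z. sweedler K C U (\<lambda>x y. f x y z) a) t"
    if t: "t \<in> carrier ?CC" for t
    by (rule tensor_linear_eqI[OF C C U is_linear_compose[OF L m1] tensor_lift_linear[OF C C U b1] _ t])
      (simp add: m1p Lp comul_closed tensor_lift_pure C U b1, simp add: l_def sweedler_def)
  have e2: "R (?m2 t) = tensor_lift K C C U (\<lambda>x b. sweedler K C U (\<lambda>y z. f x y z) b) t"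
    if t: "t \<in> carrier ?CC" for t
    by (rule tensor_linear_eqI[OF C C U is_linear_compose[OF R m2] tensor_lift_linear[OF C C U b2] _ t])
      (simp add: m2p Rp comul_closed tensor_lift_pure C U b2, simp add: r_def sweedler_def)
  have "sweedler K C U (\<lambda>a z. sweedler K C U (\<lambda>x y. f x y z) a) c = L (?m1 (comul C c))"
    by (subst sweedler_def) (simp add: e1 comul_closed c)
  also have "\<dots> = R (?m2 (comul C c))"
    using RL[OF is_linearD(1)[OF m1 comul_closed[OF c]]] coassoc[OF c] by simp
  also have "\<dots> = sweedler K C U (\<lambda>x b. sweedler K C U (\<lambda>y z. f x y z) b) c"
    by (subst (2) sweedler_def) (simp add: e2 comul_closed c)
  finally show ?thesis .
qed

text \<open>
  Counitality states this for the identity; a linear \<open>h\<close> may be applied under the sum.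
\<close>

lemma sweedler_counit_left:
  assumes U: "module K U" and h: "is_linear K C U h" and c: "c \<in> carrier C"
  shows "sweedler K C U (\<lambda>a b. counit C a \<odot>\<^bsub>U\<^esub> h b) c = h c"
proof -
  have b: "bilinear K C C C (\<lambda>a b. counit C a \<odot>\<^bsub>C\<^esub> b)"
    using is_linearD(1)[OF counit_linear]
    by (intro bilinearI is_linear_smult_const is_linear_smult is_linear_id counit_linear module_C) auto
  have "h c = h (sweedler K C C (\<lambda>a b. counit C a \<odot>\<^bsub>C\<^esub> b) c)"
    using counit_left[OF c] by (simp add: sweedler_def)
  also have "\<dots> = sweedler K C U (\<lambda>a b. h (counit C a \<odot>\<^bsub>C\<^esub> b)) c"
    by (rule linear_sweedler[OF module_C U b h c])
  also have "\<dots> = sweedler K C U (\<lambda>a b. counit C a \<odot>\<^bsub>U\<^esub> h b) c"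
    using is_linearD(1)[OF counit_linear]
    by (intro sweedler_cong U bilinear_compose[OF h b] c is_linearD(3)[OF h]) auto
  finally show ?thesis ..
qed

lemma sweedler_counit_right:
  assumes U: "module K U" and h: "is_linear K C U h" and c: "c \<in> carrier C"
  shows "sweedler K C U (\<lambda>a b. counit C b \<odot>\<^bsub>U\<^esub> h a) c = h c"
proof -
  have b: "bilinear K C C C (\<lambda>a b. counit C b \<odot>\<^bsub>C\<^esub> a)"
    using is_linearD(1)[OF counit_linear]
    by (intro bilinearI is_linear_smult_const is_linear_smult is_linear_id counit_linear module_C) auto
  have "h c = h (sweedler K C C (\<lambda>a b. counit C b \<odot>\<^bsub>C\<^esub> a) c)"
    using counit_right[OF c] by (simp add: sweedler_def)
  also have "\<dots> = sweedler K C U (\<lambda>a b. h (counit C b \<odot>\<^bsub>C\<^esub> a)) c"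
    by (rule linear_sweedler[OF module_C U b h c])
  also have "\<dots> = sweedler K C U (\<lambda>a b. counit C b \<odot>\<^bsub>U\<^esub> h a) c"
    using is_linearD(1)[OF counit_linear]
    by (intro sweedler_cong U bilinear_compose[OF h b] c is_linearD(3)[OF h]) auto
  finally show ?thesis ..
qed

end

section \<open>Colinear maps in Sweedler notation\<close>

definition left_coaction where
  "left_coaction K C D t =
    tensor_assoc K D D C (tensor_map K D C (tensor K D D) C (comul D) (\<lambda>x. x) t)"

definition right_coaction where
  "right_coaction K C D t =
    tensor_assoc_inv K D C C (tensor_map K D C D (tensor K C C) (\<lambda>x. x) (comul C) t)"

text \<open>
  The map \<open>d \<otimes> c \<mapsto> \<phi>(c\<^sub>(\<^sub>1\<^sub>) \<otimes> d\<^sub>(\<^sub>2\<^sub>)) d\<^sub>(\<^sub>1\<^sub>) \<otimes> c\<^sub>(\<^sub>2\<^sub>)\<close>, the inverse image of \<open>\<phi>\<close> under \<open>F\<close>. The sum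
  over \<open>C\<close> is the outer one, as in \<^const>\<open>star\<close>.
\<close>

definition twist ::
  "('k, 'r) ring_scheme \<Rightarrow> ('k, 'c, 'x) coalgebra_scheme \<Rightarrow> ('k, 'd, 'y) coalgebra_scheme
    \<Rightarrow> (('k, 'c, 'd) tensor \<Rightarrow> 'k) \<Rightarrow> ('k, 'd, 'c) tensor \<Rightarrow> ('k, 'd, 'c) tensor"
  where "twist K C D \<phi> = tensor_lift K D C (tensor K D C) (\<lambda>d c.
    sweedler K C (tensor K D C) (\<lambda>c\<^sub>1 c\<^sub>2.
      sweedler K D (tensor K D C) (\<lambda>d\<^sub>1 d\<^sub>2.
        \<phi> (tensor_pure K C D c\<^sub>1 d\<^sub>2) \<odot>\<^bsub>tensor K D C\<^esub> tensor_pure K D C d\<^sub>1 c\<^sub>2) d) c)"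

locale coalgebra_pair = C: coalgebra K C + D: coalgebra K D
  for K :: "('k, 'r) ring_scheme" (structure)
    and C :: "('k, 'c, 'x) coalgebra_scheme" and D :: "('k, 'd, 'y) coalgebra_scheme"
begin

abbreviation "T \<equiv> tensor K D C"
abbreviation "S \<equiv> tensor K C D"
abbreviation "k \<equiv> scalars K"
abbreviation "dc \<equiv> tensor_pure K D C"
abbreviation "cd \<equiv> tensor_pure K C D"

lemmas modules = C.module_C D.module_C module_tensor module_scalars C.R.cring_axioms

lemma counit_closed [simp]:
  "c \<in> carrier C \<Longrightarrow> counit C c \<in> carrier K" "d \<in> carrier D \<Longrightarrow> counit D d \<in> carrier K"
  using is_linearD(1)[OF C.counit_linear] is_linearD(1)[OF D.counit_linear] by auto

lemma T_smult_closed: "\<lbrakk>a \<in> carrier K; t \<in> carrier T\<rbrakk> \<Longrightarrow> a \<odot>\<^bsub>T\<^esub> t \<in> carrier T"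
  by (rule module.smult_closed[of K]) (intro modules)

text \<open>
  In the terms below each bound variable occurs exactly once, in a linear position, so these rules
  reduce bilinearity of an iterated Sweedler sum to memberships.
\<close>

lemmas linear_intros = bilinearI is_linear_id is_linear_tensor_pure_left is_linear_tensor_pure_right
  is_linear_smult is_linear_smult_const is_linear_mult
  C.is_linear_sweedler D.is_linear_sweedler C.is_linear_sweedler_param D.is_linear_sweedler_param
  is_linear_compose[OF C.counit_linear] is_linear_compose[OF D.counit_linear]
  modules tensor_pure_closed T_smult_closed counit_closed C.m_closed

lemma sweedler_swap:
  assumes "module K U" "c \<in> carrier C" "d \<in> carrier D"
    and "\<And>x y. \<lbrakk>x \<in> carrier D; y \<in> carrier D\<rbrakk> \<Longrightarrow> bilinear K C C U (\<lambda>a b. g a b x y)"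
    and "\<And>a b. \<lbrakk>a \<in> carrier C; b \<in> carrier C\<rbrakk> \<Longrightarrow> bilinear K D D U (\<lambda>x y. g a b x y)"
  shows "sweedler K C U (\<lambda>a b. sweedler K D U (\<lambda>x y. g a b x y) d) c =
    sweedler K D U (\<lambda>x y. sweedler K C U (\<lambda>a b. g a b x y) c) d"
  unfolding sweedler_def
  by (intro tensor_lift_swap C.comul_closed D.comul_closed modules assms)

lemma left_coaction_linear: "is_linear K T (tensor K D T) (left_coaction K C D)"
  unfolding left_coaction_def
  by (intro is_linear_compose[OF tensor_assoc_linear] tensor_map_linear D.comul_linear is_linear_id
      modules)

lemma left_coaction_pure:
  assumes "d \<in> carrier D" "c \<in> carrier C"
  shows "left_coaction K C D (dc d c) =
    sweedler K D (tensor K D T) (\<lambda>d\<^sub>1 d\<^sub>2. tensor_pure K D T d\<^sub>1 (dc d\<^sub>2 c)) d"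
  unfolding left_coaction_def sweedler_def
  by (simp add: tensor_map_pure tensor_assoc_pure assms modules D.comul_linear is_linear_id
      D.comul_closed)

lemma right_coaction_linear: "is_linear K T (tensor K T C) (right_coaction K C D)"
  unfolding right_coaction_def
  by (intro is_linear_compose[OF tensor_assoc_inv_linear] tensor_map_linear C.comul_linear
      is_linear_id modules)

lemma right_coaction_pure:
  assumes "d \<in> carrier D" "c \<in> carrier C"
  shows "right_coaction K C D (dc d c) =
    sweedler K C (tensor K T C) (\<lambda>c\<^sub>1 c\<^sub>2. tensor_pure K T C (dc d c\<^sub>1) c\<^sub>2) c"
  unfolding right_coaction_def sweedler_def
  by (simp add: tensor_map_pure tensor_assoc_inv_pure assms modules C.comul_linear is_linear_id
      C.comul_closed)

lemma left_colinear_eq: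
  "left_colinear K C D f \<longleftrightarrow> (\<forall>t\<in>carrier T. left_coaction K C D (f t) =
    tensor_map K D T D T (\<lambda>x. x) f (left_coaction K C D t))"
  by (simp add: left_colinear_def left_coaction_def Let_def)

lemma right_colinear_eq:
  "right_colinear K C D f \<longleftrightarrow> (\<forall>t\<in>carrier T. right_coaction K C D (f t) =
    tensor_map K T C T C f (\<lambda>x. x) (right_coaction K C D t))"
  by (simp add: right_colinear_def right_coaction_def Let_def)

text \<open>
  Both sides of the colinearity condition are linear, so pure tensors suffice; there the coaction is a
  Sweedler sum.
\<close>

lemma left_colinear_iff:
  assumes f: "is_linear K T T f"
  shows "left_colinear K C D f \<longleftrightarrow> (\<forall>d\<in>carrier D. \<forall>c\<in>carrier C.
    left_coaction K C D (f (dc d c)) =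
    sweedler K D (tensor K D T) (\<lambda>d\<^sub>1 d\<^sub>2. tensor_pure K D T d\<^sub>1 (f (dc d\<^sub>2 c))) d)"
proof -
  note m = tensor_map_linear[OF D.module_C module_tensor D.module_C module_tensor is_linear_id f,
      OF D.module_C C.module_C D.module_C C.module_C]
  have "tensor_map K D T D T (\<lambda>x. x) f (left_coaction K C D (dc d c)) =
      sweedler K D (tensor K D T) (\<lambda>d\<^sub>1 d\<^sub>2. tensor_pure K D T d\<^sub>1 (f (dc d\<^sub>2 c))) d"
    if d: "d \<in> carrier D" and c: "c \<in> carrier C" for d c
  proof -
    have b: "bilinear K D D (tensor K D T) (\<lambda>d\<^sub>1 d\<^sub>2. tensor_pure K D T d\<^sub>1 (dc d\<^sub>2 c))"
      using c by (intro linear_intros)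
    have "tensor_map K D T D T (\<lambda>x. x) f (left_coaction K C D (dc d c)) =
        sweedler K D (tensor K D T) (\<lambda>d\<^sub>1 d\<^sub>2.
          tensor_map K D T D T (\<lambda>x. x) f (tensor_pure K D T d\<^sub>1 (dc d\<^sub>2 c))) d"
      unfolding left_coaction_pure[OF d c]
      by (rule D.linear_sweedler[OF _ _ b m d]) (intro modules)+
    also have "\<dots> = sweedler K D (tensor K D T) (\<lambda>d\<^sub>1 d\<^sub>2. tensor_pure K D T d\<^sub>1 (f (dc d\<^sub>2 c))) d"
      by (rule D.sweedler_cong[OF _ bilinear_compose[OF m b] d])
        (simp_all add: tensor_map_pure modules is_linear_id f c)
    finally show ?thesis .
  qed
  note pure = this
  show ?thesis unfolding left_colinear_eq
  proof (intro iffI ballI)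
    fix d c assume "\<forall>t\<in>carrier T. left_coaction K C D (f t) = tensor_map K D T D T (\<lambda>x. x) f (left_coaction K C D t)" and d: "d \<in> carrier D" and c: "c \<in> carrier C"
    then have "left_coaction K C D (f (dc d c)) = tensor_map K D T D T (\<lambda>x. x) f (left_coaction K C D (dc d c))" by (simp add: modules)
    then show "left_coaction K C D (f (dc d c)) = sweedler K D (tensor K D T) (\<lambda>d\<^sub>1 d\<^sub>2. tensor_pure K D T d\<^sub>1 (f (dc d\<^sub>2 c))) d" using pure[OF d c] by simp
  next
    fix t assume "\<forall>d\<in>carrier D. \<forall>c\<in>carrier C. left_coaction K C D (f (dc d c)) = sweedler K D (tensor K D T) (\<lambda>d\<^sub>1 d\<^sub>2. tensor_pure K D T d\<^sub>1 (f (dc d\<^sub>2 c))) d" and t: "t \<in> carrier T"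
    then show "left_coaction K C D (f t) = tensor_map K D T D T (\<lambda>x. x) f (left_coaction K C D t)"
      using pure by (intro tensor_linear_eqI[OF D.module_C C.module_C _
            is_linear_compose[OF left_coaction_linear f] is_linear_compose[OF m left_coaction_linear] _ t])
        (simp_all add: modules)
  qed
qed

lemma right_colinear_iff:
  assumes f: "is_linear K T T f"
  shows "right_colinear K C D f \<longleftrightarrow> (\<forall>d\<in>carrier D. \<forall>c\<in>carrier C.
    right_coaction K C D (f (dc d c)) =
    sweedler K C (tensor K T C) (\<lambda>c\<^sub>1 c\<^sub>2. tensor_pure K T C (f (dc d c\<^sub>1)) c\<^sub>2) c)"
proof -
  note m = tensor_map_linear[OF module_tensor C.module_C module_tensor C.module_C f is_linear_id,
      OF D.module_C C.module_C D.module_C C.module_C]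
  have "tensor_map K T C T C f (\<lambda>x. x) (right_coaction K C D (dc d c)) =
      sweedler K C (tensor K T C) (\<lambda>c\<^sub>1 c\<^sub>2. tensor_pure K T C (f (dc d c\<^sub>1)) c\<^sub>2) c"
    if d: "d \<in> carrier D" and c: "c \<in> carrier C" for d c
  proof -
    have b: "bilinear K C C (tensor K T C) (\<lambda>c\<^sub>1 c\<^sub>2. tensor_pure K T C (dc d c\<^sub>1) c\<^sub>2)"
      using d by (intro linear_intros)
    have "tensor_map K T C T C f (\<lambda>x. x) (right_coaction K C D (dc d c)) =
        sweedler K C (tensor K T C) (\<lambda>c\<^sub>1 c\<^sub>2.
          tensor_map K T C T C f (\<lambda>x. x) (tensor_pure K T C (dc d c\<^sub>1) c\<^sub>2)) c"
      unfolding right_coaction_pure[OF d c]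
      by (rule C.linear_sweedler[OF _ _ b m c]) (intro modules)+
    also have "\<dots> = sweedler K C (tensor K T C) (\<lambda>c\<^sub>1 c\<^sub>2. tensor_pure K T C (f (dc d c\<^sub>1)) c\<^sub>2) c"
      by (rule C.sweedler_cong[OF _ bilinear_compose[OF m b] c])
        (simp_all add: tensor_map_pure modules is_linear_id f d)
    finally show ?thesis .
  qed
  note pure = this
  show ?thesis unfolding right_colinear_eq
  proof (intro iffI ballI)
    fix d c assume "\<forall>t\<in>carrier T. right_coaction K C D (f t) = tensor_map K T C T C f (\<lambda>x. x) (right_coaction K C D t)" and d: "d \<in> carrier D" and c: "c \<in> carrier C"
    then have "right_coaction K C D (f (dc d c)) = tensor_map K T C T C f (\<lambda>x. x) (right_coaction K C D (dc d c))" by (simp add: modules)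
    then show "right_coaction K C D (f (dc d c)) = sweedler K C (tensor K T C) (\<lambda>c\<^sub>1 c\<^sub>2. tensor_pure K T C (f (dc d c\<^sub>1)) c\<^sub>2) c" using pure[OF d c] by simp
  next
    fix t assume "\<forall>d\<in>carrier D. \<forall>c\<in>carrier C. right_coaction K C D (f (dc d c)) = sweedler K C (tensor K T C) (\<lambda>c\<^sub>1 c\<^sub>2. tensor_pure K T C (f (dc d c\<^sub>1)) c\<^sub>2) c" and t: "t \<in> carrier T"
    then show "right_coaction K C D (f t) = tensor_map K T C T C f (\<lambda>x. x) (right_coaction K C D t)"
      using pure by (intro tensor_linear_eqI[OF D.module_C C.module_C _
            is_linear_compose[OF right_coaction_linear f] is_linear_compose[OF m right_coaction_linear] _ t])
        (simp_all add: modules)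
  qed
qed

lemma counit_tensor_linear_maps: "counit_tensor K D C \<in> linear_maps K T k"
  and counit_tensor_pure: "\<lbrakk>d \<in> carrier D; c \<in> carrier C\<rbrakk> \<Longrightarrow>
    counit_tensor K D C (dc d c) = counit D d \<otimes> counit C c"
proof -
  have "bilinear K D C k (\<lambda>d c. counit D d \<otimes> counit C c)"
    by (intro linear_intros)
  then show "counit_tensor K D C \<in> linear_maps K T k"
    "\<lbrakk>d \<in> carrier D; c \<in> carrier C\<rbrakk> \<Longrightarrow> counit_tensor K D C (dc d c) = counit D d \<otimes> counit C c"
    unfolding counit_tensor_def
    by (simp_all add: tensor_lift_pure tensor_lift_linear_maps modules)
qed

lemma counit_tensor_linear: "is_linear K T k (counit_tensor K D C)"
  using counit_tensor_linear_maps by (simp add: linear_maps_def)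

lemma F_map_linear_maps:
  assumes f: "is_linear K T T f"
  shows "F_map K C D f \<in> linear_maps K S k"
    and F_map_pure: "\<lbrakk>c \<in> carrier C; d \<in> carrier D\<rbrakk> \<Longrightarrow>
      F_map K C D f (cd c d) = counit_tensor K D C (f (dc d c))"
proof -
  have flip: "is_linear K S T (tensor_flip K C D)" by (intro tensor_flip_linear modules)
  have "is_linear K S k (F_map K C D f)"
    by (rule is_linear_cong[OF _ is_linear_compose[OF counit_tensor_linear is_linear_compose[OF f flip]]])
      (simp_all add: modules F_map_def compose_eq)
  then show "F_map K C D f \<in> linear_maps K S k"
    by (simp add: linear_maps_def F_map_def)
  show "F_map K C D f (cd c d) = counit_tensor K D C (f (dc d c))"
    if "c \<in> carrier C" "d \<in> carrier D"
    using that by (simp add: F_map_def compose_eq modules tensor_flip_pure)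
qed

section \<open>The colinear map of a functional\<close>

context
  fixes \<phi> assumes phi: "is_linear K S k \<phi>"
begin

lemma phi_closed: "\<lbrakk>c \<in> carrier C; d \<in> carrier D\<rbrakk> \<Longrightarrow> \<phi> (cd c d) \<in> carrier K"
  using is_linearD(1)[OF phi] by (simp add: modules)

lemmas phi_linear_intros = linear_intros is_linear_compose[OF phi] phi_closed

lemma twist_bilinear_inner:
  assumes "c\<^sub>1 \<in> carrier C" "c\<^sub>2 \<in> carrier C"
  shows "bilinear K D D T (\<lambda>d\<^sub>1 d\<^sub>2. \<phi> (cd c\<^sub>1 d\<^sub>2) \<odot>\<^bsub>T\<^esub> dc d\<^sub>1 c\<^sub>2)"
  using assms by (intro phi_linear_intros)

lemma twist_bilinear_outer:
  assumes "d \<in> carrier D"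
  shows "bilinear K C C T (\<lambda>c\<^sub>1 c\<^sub>2. sweedler K D T (\<lambda>d\<^sub>1 d\<^sub>2. \<phi> (cd c\<^sub>1 d\<^sub>2) \<odot>\<^bsub>T\<^esub> dc d\<^sub>1 c\<^sub>2) d)"
  using assms by (intro phi_linear_intros)

lemma twist_bilinear:
  "bilinear K D C T (\<lambda>d c. sweedler K C T (\<lambda>c\<^sub>1 c\<^sub>2.
    sweedler K D T (\<lambda>d\<^sub>1 d\<^sub>2. \<phi> (cd c\<^sub>1 d\<^sub>2) \<odot>\<^bsub>T\<^esub> dc d\<^sub>1 c\<^sub>2) d) c)"
  by (intro phi_linear_intros)

lemma twist_linear_maps: "twist K C D \<phi> \<in> linear_maps K T T"
  unfolding twist_def by (intro tensor_lift_linear_maps twist_bilinear modules)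

lemma twist_linear: "is_linear K T T (twist K C D \<phi>)"
  using twist_linear_maps by (simp add: linear_maps_def)

lemma twist_pure:
  "\<lbrakk>d \<in> carrier D; c \<in> carrier C\<rbrakk> \<Longrightarrow> twist K C D \<phi> (dc d c) =
    sweedler K C T (\<lambda>c\<^sub>1 c\<^sub>2. sweedler K D T (\<lambda>d\<^sub>1 d\<^sub>2. \<phi> (cd c\<^sub>1 d\<^sub>2) \<odot>\<^bsub>T\<^esub> dc d\<^sub>1 c\<^sub>2) d) c"
  unfolding twist_def by (intro tensor_lift_pure twist_bilinear modules)

lemma linear_twist:
  assumes U: "module K U" and h: "is_linear K T U h" and d: "d \<in> carrier D" and c: "c \<in> carrier C"
  shows "h (twist K C D \<phi> (dc d c)) = sweedler K C U (\<lambda>c\<^sub>1 c\<^sub>2.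
    sweedler K D U (\<lambda>d\<^sub>1 d\<^sub>2. \<phi> (cd c\<^sub>1 d\<^sub>2) \<odot>\<^bsub>U\<^esub> h (dc d\<^sub>1 c\<^sub>2)) d) c"
proof -
  have T: "module K T" by (intro modules)
  have "h (twist K C D \<phi> (dc d c)) =
      sweedler K C U (\<lambda>c\<^sub>1 c\<^sub>2. h (sweedler K D T (\<lambda>d\<^sub>1 d\<^sub>2. \<phi> (cd c\<^sub>1 d\<^sub>2) \<odot>\<^bsub>T\<^esub> dc d\<^sub>1 c\<^sub>2) d)) c"
    unfolding twist_pure[OF d c]
    by (rule C.linear_sweedler[OF T U twist_bilinear_outer[OF d] h c])
  also have "\<dots> = sweedler K C U (\<lambda>c\<^sub>1 c\<^sub>2.
      sweedler K D U (\<lambda>d\<^sub>1 d\<^sub>2. \<phi> (cd c\<^sub>1 d\<^sub>2) \<odot>\<^bsub>U\<^esub> h (dc d\<^sub>1 c\<^sub>2)) d) c"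
  proof (rule C.sweedler_cong[OF U bilinear_compose[OF h twist_bilinear_outer[OF d]] c])
    fix a b assume ab: "a \<in> carrier C" "b \<in> carrier C"
    have "h (sweedler K D T (\<lambda>d\<^sub>1 d\<^sub>2. \<phi> (cd a d\<^sub>2) \<odot>\<^bsub>T\<^esub> dc d\<^sub>1 b) d) =
        sweedler K D U (\<lambda>d\<^sub>1 d\<^sub>2. h (\<phi> (cd a d\<^sub>2) \<odot>\<^bsub>T\<^esub> dc d\<^sub>1 b)) d"
      by (rule D.linear_sweedler[OF T U twist_bilinear_inner[OF ab] h d])
    also have "\<dots> = sweedler K D U (\<lambda>d\<^sub>1 d\<^sub>2. \<phi> (cd a d\<^sub>2) \<odot>\<^bsub>U\<^esub> h (dc d\<^sub>1 b)) d"
      by (rule D.sweedler_cong[OF U bilinear_compose[OF h twist_bilinear_inner[OF ab]] d])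
        (simp add: is_linearD(3)[OF h] phi_closed modules ab)
    finally show "h (sweedler K D T (\<lambda>d\<^sub>1 d\<^sub>2. \<phi> (cd a d\<^sub>2) \<odot>\<^bsub>T\<^esub> dc d\<^sub>1 b) d) =
      sweedler K D U (\<lambda>d\<^sub>1 d\<^sub>2. \<phi> (cd a d\<^sub>2) \<odot>\<^bsub>U\<^esub> h (dc d\<^sub>1 b)) d" .
  qed
  finally show ?thesis .
qed


text \<open>
  On either side one arrives at the sum of \<open>\<phi>(x \<otimes> d\<^sub>(\<^sub>2\<^sub>)) (d\<^sub>(\<^sub>1\<^sub>) \<otimes> y) \<otimes> z\<close> over a threefold
  comultiplication of \<open>c\<close> into \<open>x, y, z\<close>: the coaction splits \<open>c\<^sub>(\<^sub>2\<^sub>)\<close> if it is applied after \<open>twist\<close>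
  and \<open>c\<close> itself if applied before.
\<close>

lemma twist_right_colinear: "right_colinear K C D (twist K C D \<phi>)"
proof (unfold right_colinear_iff[OF twist_linear], intro ballI)
  fix d c assume d: "d \<in> carrier D" and c: "c \<in> carrier C"
  let ?U = "tensor K T C"
  have T: "module K T" and U: "module K ?U" by (intro modules)+
  note intros = phi_linear_intros U module.smult_closed[OF U]
  let ?G = "\<lambda>x y z. sweedler K D ?U (\<lambda>d\<^sub>1 d\<^sub>2. \<phi> (cd x d\<^sub>2) \<odot>\<^bsub>?U\<^esub> tensor_pure K T C (dc d\<^sub>1 y) z) d"
  have rc: "sweedler K D ?U (\<lambda>d\<^sub>1 d\<^sub>2. \<phi> (cd x d\<^sub>2) \<odot>\<^bsub>?U\<^esub> right_coaction K C D (dc d\<^sub>1 b)) d =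
      sweedler K C ?U (\<lambda>y z. ?G x y z) b" if x: "x \<in> carrier C" and b: "b \<in> carrier C" for x b
  proof -
    have "sweedler K D ?U (\<lambda>d\<^sub>1 d\<^sub>2. \<phi> (cd x d\<^sub>2) \<odot>\<^bsub>?U\<^esub> right_coaction K C D (dc d\<^sub>1 b)) d =
        sweedler K D ?U (\<lambda>d\<^sub>1 d\<^sub>2. sweedler K C ?U
          (\<lambda>y z. \<phi> (cd x d\<^sub>2) \<odot>\<^bsub>?U\<^esub> tensor_pure K T C (dc d\<^sub>1 y) z) b) d"
    proof (rule D.sweedler_cong[OF U _ d])
      show "bilinear K D D ?U (\<lambda>d\<^sub>1 d\<^sub>2. \<phi> (cd x d\<^sub>2) \<odot>\<^bsub>?U\<^esub> right_coaction K C D (dc d\<^sub>1 b))"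
        using x b by (intro intros is_linear_compose[OF right_coaction_linear]
            is_linearD(1)[OF right_coaction_linear])
      fix d\<^sub>1 d\<^sub>2 assume dd: "d\<^sub>1 \<in> carrier D" "d\<^sub>2 \<in> carrier D"
      show "\<phi> (cd x d\<^sub>2) \<odot>\<^bsub>?U\<^esub> right_coaction K C D (dc d\<^sub>1 b) =
          sweedler K C ?U (\<lambda>y z. \<phi> (cd x d\<^sub>2) \<odot>\<^bsub>?U\<^esub> tensor_pure K T C (dc d\<^sub>1 y) z) b"
        unfolding right_coaction_pure[OF dd(1) b]
        using x b dd by (intro C.linear_sweedler[OF U U] intros)
    qed
    also have "\<dots> = sweedler K C ?U (\<lambda>y z. ?G x y z) b"
      using x b d by (intro sweedler_swap[symmetric] intros)
    finally show ?thesis .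
  qed
  have "right_coaction K C D (twist K C D \<phi> (dc d c)) =
      sweedler K C ?U (\<lambda>x b. sweedler K D ?U
        (\<lambda>d\<^sub>1 d\<^sub>2. \<phi> (cd x d\<^sub>2) \<odot>\<^bsub>?U\<^esub> right_coaction K C D (dc d\<^sub>1 b)) d) c"
    by (rule linear_twist[OF U right_coaction_linear d c])
  also have "\<dots> = sweedler K C ?U (\<lambda>x b. sweedler K C ?U (\<lambda>y z. ?G x y z) b) c"
  proof (rule C.sweedler_cong[OF U _ c rc])
    show "bilinear K C C ?U (\<lambda>x b. sweedler K D ?U
        (\<lambda>d\<^sub>1 d\<^sub>2. \<phi> (cd x d\<^sub>2) \<odot>\<^bsub>?U\<^esub> right_coaction K C D (dc d\<^sub>1 b)) d)"
      using d by (intro intros is_linear_compose[OF right_coaction_linear]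
          is_linearD(1)[OF right_coaction_linear])
  qed
  also have "\<dots> = sweedler K C ?U (\<lambda>a z. sweedler K C ?U (\<lambda>x y. ?G x y z) a) c"
    using d by (intro C.sweedler_coassoc[OF U c, symmetric] intros)
  also have "\<dots> = sweedler K C ?U (\<lambda>a z. tensor_pure K T C (twist K C D \<phi> (dc d a)) z) c"
  proof (rule C.sweedler_cong[OF U _ c])
    show "bilinear K C C ?U (\<lambda>a z. sweedler K C ?U (\<lambda>x y. ?G x y z) a)"
      using d by (intro intros)
    fix a z assume a: "a \<in> carrier C" and z: "z \<in> carrier C"
    show "sweedler K C ?U (\<lambda>x y. ?G x y z) a = tensor_pure K T C (twist K C D \<phi> (dc d a)) z"
      using a z d by (intro linear_twist[OF U, of "\<lambda>t. tensor_pure K T C t z", symmetric] intros)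
  qed
  finally show "right_coaction K C D (twist K C D \<phi> (dc d c)) =
      sweedler K C ?U (\<lambda>c\<^sub>1 c\<^sub>2. tensor_pure K T C (twist K C D \<phi> (dc d c\<^sub>1)) c\<^sub>2) c" .
qed

text \<open>
  The mirror image, by coassociativity of \<open>D\<close>. As the sum over \<open>D\<close> is the inner one in \<open>twist\<close>, the
  two sums have to be exchanged at the end.
\<close>

lemma twist_left_colinear: "left_colinear K C D (twist K C D \<phi>)"
proof (unfold left_colinear_iff[OF twist_linear], intro ballI)
  fix d c assume d: "d \<in> carrier D" and c: "c \<in> carrier C"
  let ?U = "tensor K D T"
  have T: "module K T" and U: "module K ?U" by (intro modules)+
  note intros = phi_linear_intros U module.smult_closed[OF U]
  let ?H = "\<lambda>c\<^sub>1 c\<^sub>2 x y z. \<phi> (cd c\<^sub>1 z) \<odot>\<^bsub>?U\<^esub> tensor_pure K D T x (dc y c\<^sub>2)"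
  have lc: "sweedler K D ?U (\<lambda>a z. \<phi> (cd c\<^sub>1 z) \<odot>\<^bsub>?U\<^esub> left_coaction K C D (dc a c\<^sub>2)) d =
      sweedler K D ?U (\<lambda>x b. sweedler K D ?U (\<lambda>y z. ?H c\<^sub>1 c\<^sub>2 x y z) b) d"
    if cc: "c\<^sub>1 \<in> carrier C" "c\<^sub>2 \<in> carrier C" for c\<^sub>1 c\<^sub>2
  proof -
    have "sweedler K D ?U (\<lambda>a z. \<phi> (cd c\<^sub>1 z) \<odot>\<^bsub>?U\<^esub> left_coaction K C D (dc a c\<^sub>2)) d =
      sweedler K D ?U (\<lambda>a z. sweedler K D ?U (\<lambda>x y. ?H c\<^sub>1 c\<^sub>2 x y z) a) d"
    proof (rule D.sweedler_cong[OF U _ d])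
      show "bilinear K D D ?U (\<lambda>a z. \<phi> (cd c\<^sub>1 z) \<odot>\<^bsub>?U\<^esub> left_coaction K C D (dc a c\<^sub>2))"
        using cc by (intro intros is_linear_compose[OF left_coaction_linear]
            is_linearD(1)[OF left_coaction_linear])
      fix a z assume az: "a \<in> carrier D" "z \<in> carrier D"
      show "\<phi> (cd c\<^sub>1 z) \<odot>\<^bsub>?U\<^esub> left_coaction K C D (dc a c\<^sub>2) =
          sweedler K D ?U (\<lambda>x y. ?H c\<^sub>1 c\<^sub>2 x y z) a"
        unfolding left_coaction_pure[OF az(1) cc(2)]
        using cc az by (intro D.linear_sweedler[OF U U] intros)
    qed
    also have "\<dots> = sweedler K D ?U (\<lambda>x b. sweedler K D ?U (\<lambda>y z. ?H c\<^sub>1 c\<^sub>2 x y z) b) d"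
      using cc by (intro D.sweedler_coassoc[OF U d] intros)
    finally show ?thesis .
  qed
  have "left_coaction K C D (twist K C D \<phi> (dc d c)) =
      sweedler K C ?U (\<lambda>c\<^sub>1 c\<^sub>2. sweedler K D ?U
        (\<lambda>a z. \<phi> (cd c\<^sub>1 z) \<odot>\<^bsub>?U\<^esub> left_coaction K C D (dc a c\<^sub>2)) d) c"
    by (rule linear_twist[OF U left_coaction_linear d c])
  also have "\<dots> = sweedler K C ?U (\<lambda>c\<^sub>1 c\<^sub>2.
      sweedler K D ?U (\<lambda>x b. sweedler K D ?U (\<lambda>y z. ?H c\<^sub>1 c\<^sub>2 x y z) b) d) c"
  proof (rule C.sweedler_cong[OF U _ c lc])
    show "bilinear K C C ?U (\<lambda>c\<^sub>1 c\<^sub>2. sweedler K D ?U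
        (\<lambda>a z. \<phi> (cd c\<^sub>1 z) \<odot>\<^bsub>?U\<^esub> left_coaction K C D (dc a c\<^sub>2)) d)"
      using d by (intro intros is_linear_compose[OF left_coaction_linear]
          is_linearD(1)[OF left_coaction_linear])
  qed
  also have "\<dots> = sweedler K D ?U (\<lambda>x b.
      sweedler K C ?U (\<lambda>c\<^sub>1 c\<^sub>2. sweedler K D ?U (\<lambda>y z. ?H c\<^sub>1 c\<^sub>2 x y z) b) c) d"
    using c d by (intro sweedler_swap intros)
  also have "\<dots> = sweedler K D ?U (\<lambda>x b. tensor_pure K D T x (twist K C D \<phi> (dc b c))) d"
  proof (rule D.sweedler_cong[OF U _ d])
    show "bilinear K D D ?U (\<lambda>x b.
        sweedler K C ?U (\<lambda>c\<^sub>1 c\<^sub>2. sweedler K D ?U (\<lambda>y z. ?H c\<^sub>1 c\<^sub>2 x y z) b) c)"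
      using c by (intro intros)
    fix x b assume x: "x \<in> carrier D" and b: "b \<in> carrier D"
    show "sweedler K C ?U (\<lambda>c\<^sub>1 c\<^sub>2. sweedler K D ?U (\<lambda>y z. ?H c\<^sub>1 c\<^sub>2 x y z) b) c =
        tensor_pure K D T x (twist K C D \<phi> (dc b c))"
      using x b c by (intro linear_twist[OF U, symmetric] intros)
  qed
  finally show "left_coaction K C D (twist K C D \<phi> (dc d c)) =
      sweedler K D ?U (\<lambda>d\<^sub>1 d\<^sub>2. tensor_pure K D T d\<^sub>1 (twist K C D \<phi> (dc d\<^sub>2 c))) d" .
qed

text \<open>
  The factors \<open>\<epsilon>\<^sub>D(d\<^sub>(\<^sub>1\<^sub>))\<close> and \<open>\<epsilon>\<^sub>C(c\<^sub>(\<^sub>2\<^sub>))\<close> collapse the two sums.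
\<close>

lemma F_map_twist_pure:
  assumes c: "c \<in> carrier C" and d: "d \<in> carrier D"
  shows "F_map K C D (twist K C D \<phi>) (cd c d) = \<phi> (cd c d)"
proof -
  have k: "module K k" by (intro modules)
  note intros = phi_linear_intros is_linear_compose[OF counit_tensor_linear]
    is_linearD(1)[OF counit_tensor_linear, simplified]
  have in_d: "sweedler K D k (\<lambda>d\<^sub>1 d\<^sub>2. \<phi> (cd c\<^sub>1 d\<^sub>2) \<otimes> counit_tensor K D C (dc d\<^sub>1 c\<^sub>2)) d =
      counit C c\<^sub>2 \<otimes> \<phi> (cd c\<^sub>1 d)" if cc: "c\<^sub>1 \<in> carrier C" "c\<^sub>2 \<in> carrier C" for c\<^sub>1 c\<^sub>2
  proof -
    have "sweedler K D k (\<lambda>d\<^sub>1 d\<^sub>2. \<phi> (cd c\<^sub>1 d\<^sub>2) \<otimes> counit_tensor K D C (dc d\<^sub>1 c\<^sub>2)) d =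
        sweedler K D k (\<lambda>d\<^sub>1 d\<^sub>2. counit D d\<^sub>1 \<odot>\<^bsub>k\<^esub> (counit C c\<^sub>2 \<otimes> \<phi> (cd c\<^sub>1 d\<^sub>2))) d"
    proof (rule D.sweedler_cong[OF k _ d])
      show "bilinear K D D k (\<lambda>d\<^sub>1 d\<^sub>2. \<phi> (cd c\<^sub>1 d\<^sub>2) \<otimes> counit_tensor K D C (dc d\<^sub>1 c\<^sub>2))"
        using cc by (intro intros)
    qed (simp add: counit_tensor_pure cc phi_closed C.m_ac)
    also have "\<dots> = counit C c\<^sub>2 \<otimes> \<phi> (cd c\<^sub>1 d)"
      using cc by (intro D.sweedler_counit_left[OF k _ d] intros)
    finally show ?thesis .
  qed
  have "F_map K C D (twist K C D \<phi>) (cd c d) =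
      sweedler K C k (\<lambda>c\<^sub>1 c\<^sub>2. sweedler K D k
        (\<lambda>d\<^sub>1 d\<^sub>2. \<phi> (cd c\<^sub>1 d\<^sub>2) \<odot>\<^bsub>k\<^esub> counit_tensor K D C (dc d\<^sub>1 c\<^sub>2)) d) c"
    by (simp only: F_map_pure[OF twist_linear c d] linear_twist[OF k counit_tensor_linear d c])
  also have "\<dots> = sweedler K C k (\<lambda>c\<^sub>1 c\<^sub>2. counit C c\<^sub>2 \<odot>\<^bsub>k\<^esub> \<phi> (cd c\<^sub>1 d)) c"
  proof (rule C.sweedler_cong[OF k _ c])
    show "bilinear K C C k (\<lambda>c\<^sub>1 c\<^sub>2. sweedler K D k
        (\<lambda>d\<^sub>1 d\<^sub>2. \<phi> (cd c\<^sub>1 d\<^sub>2) \<odot>\<^bsub>k\<^esub> counit_tensor K D C (dc d\<^sub>1 c\<^sub>2)) d)"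
      using d unfolding scalars_simps by (intro intros)
  qed (simp add: in_d)
  also have "\<dots> = \<phi> (cd c d)"
    using d by (intro C.sweedler_counit_right[OF k _ c] intros)
  finally show ?thesis .
qed

end

section \<open>The functional of a colinear map\<close>

text \<open>
  That is, \<open>f(d \<otimes> c) = d\<^sub>(\<^sub>1\<^sub>) \<otimes> (\<epsilon>\<^sub>D \<otimes> id) f(d\<^sub>(\<^sub>2\<^sub>) \<otimes> c)\<close>. With \<open>E = \<epsilon>\<^sub>D \<otimes> id\<close> the map \<open>M = id \<otimes> E\<close> is a
  left inverse of the coaction; it is applied to both sides of the colinearity condition.
\<close>

lemma left_colinear_expand:
  assumes f: "is_linear K T T f" and colin: "left_colinear K C D f"
    and d: "d \<in> carrier D" and c: "c \<in> carrier C"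
  shows "f (dc d c) = sweedler K D T
    (\<lambda>x y. dc x (tensor_lift K D C C (\<lambda>d c. counit D d \<odot>\<^bsub>C\<^esub> c) (f (dc y c)))) d"
proof -
  define E where "E = tensor_lift K D C C (\<lambda>d c. counit D d \<odot>\<^bsub>C\<^esub> c)"
  define M where "M = tensor_lift K D T T (\<lambda>x t. dc x (E t))"
  have T: "module K T" and U: "module K (tensor K D T)" by (intro modules)+
  have b: "bilinear K D C C (\<lambda>d c. counit D d \<odot>\<^bsub>C\<^esub> c)" by (intro linear_intros)
  have E: "is_linear K T C E" unfolding E_def by (intro tensor_lift_linear modules b)
  have Ep: "E (dc x y) = counit D x \<odot>\<^bsub>C\<^esub> y" if "x \<in> carrier D" "y \<in> carrier C" for x y
    unfolding E_def using that by (intro tensor_lift_pure modules b)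
  note intros = linear_intros is_linear_compose[OF E] is_linearD(1)[OF E]
    is_linear_compose[OF f] is_linearD(1)[OF f] U
  have bM: "bilinear K D T T (\<lambda>x t. dc x (E t))" by (intro intros E)
  have M: "is_linear K (tensor K D T) T M" unfolding M_def by (intro tensor_lift_linear modules bM)
  have Mp: "M (tensor_pure K D T x t) = dc x (E t)" if "x \<in> carrier D" "t \<in> carrier T" for x t
    unfolding M_def using that by (intro tensor_lift_pure modules bM)
  have Msw: "M (sweedler K D (tensor K D T) (\<lambda>x y. tensor_pure K D T x (g (dc y c))) d) =
      sweedler K D T (\<lambda>x y. dc x (E (g (dc y c)))) d"
    if g: "is_linear K T T g" and d: "d \<in> carrier D" and c: "c \<in> carrier C" for g d c
  proof -
    have bg: "bilinear K D D (tensor K D T) (\<lambda>x y. tensor_pure K D T x (g (dc y c)))"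
      using c by (intro linear_intros is_linear_compose[OF g] is_linearD(1)[OF g])
    have "M (sweedler K D (tensor K D T) (\<lambda>x y. tensor_pure K D T x (g (dc y c))) d) =
        sweedler K D T (\<lambda>x y. M (tensor_pure K D T x (g (dc y c)))) d"
      by (rule D.linear_sweedler[OF U T bg M d])
    also have "\<dots> = sweedler K D T (\<lambda>x y. dc x (E (g (dc y c)))) d"
      by (rule D.sweedler_cong[OF T bilinear_compose[OF M bg] d])
        (simp add: Mp is_linearD(1)[OF g] modules c)
    finally show ?thesis .
  qed
  have id: "M (left_coaction K C D t) = t" if t: "t \<in> carrier T" for t
  proof (rule tensor_linear_eqI[OF D.module_C C.module_C T
        is_linear_compose[OF M left_coaction_linear] is_linear_id _ t])
    fix d c assume d: "d \<in> carrier D" and c: "c \<in> carrier C"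
    have "M (left_coaction K C D (dc d c)) = sweedler K D T (\<lambda>x y. dc x (E (dc y c))) d"
      unfolding left_coaction_pure[OF d c] by (rule Msw[OF is_linear_id d c])
    also have "\<dots> = sweedler K D T (\<lambda>x y. counit D y \<odot>\<^bsub>T\<^esub> dc x c) d"
    proof (rule D.sweedler_cong[OF T _ d])
      show "bilinear K D D T (\<lambda>x y. dc x (E (dc y c)))" using c by (intro intros)
      show "dc x (E (dc y c)) = counit D y \<odot>\<^bsub>T\<^esub> dc x c" if "x \<in> carrier D" "y \<in> carrier D" for x y
        using that c is_linearD(3)[OF bilinearD(2)[OF tensor_pure_bilinear[OF D.module_C C.module_C]]]
        by (simp add: Ep)
    qed
    also have "\<dots> = dc d c"
      using c by (intro D.sweedler_counit_right[OF T _ d] linear_intros)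
    finally show "M (left_coaction K C D (dc d c)) = dc d c" .
  qed
  have "f (dc d c) = M (left_coaction K C D (f (dc d c)))"
    by (rule id[symmetric]) (simp add: is_linearD(1)[OF f] modules d c)
  also have "\<dots> = sweedler K D T (\<lambda>x y. dc x (E (f (dc y c)))) d"
    using colin d c Msw[OF f d c] unfolding left_colinear_iff[OF f] by simp
  finally show ?thesis unfolding E_def .
qed

lemma right_colinear_expand:
  assumes f: "is_linear K T T f" and colin: "right_colinear K C D f"
    and d: "d \<in> carrier D" and c: "c \<in> carrier C"
  shows "f (dc d c) = sweedler K C T
    (\<lambda>x y. dc (tensor_lift K D C D (\<lambda>d c. counit C c \<odot>\<^bsub>D\<^esub> d) (f (dc d x))) y) c"
proof -
  define E where "E = tensor_lift K D C D (\<lambda>d c. counit C c \<odot>\<^bsub>D\<^esub> d)"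
  define M where "M = tensor_lift K T C T (\<lambda>t y. dc (E t) y)"
  have T: "module K T" and U: "module K (tensor K T C)" by (intro modules)+
  have b: "bilinear K D C D (\<lambda>d c. counit C c \<odot>\<^bsub>D\<^esub> d)" by (intro linear_intros)
  have E: "is_linear K T D E" unfolding E_def by (intro tensor_lift_linear modules b)
  have Ep: "E (dc x y) = counit C y \<odot>\<^bsub>D\<^esub> x" if "x \<in> carrier D" "y \<in> carrier C" for x y
    unfolding E_def using that by (intro tensor_lift_pure modules b)
  note intros = linear_intros is_linear_compose[OF E] is_linearD(1)[OF E]
    is_linear_compose[OF f] is_linearD(1)[OF f] U
  have bM: "bilinear K T C T (\<lambda>t y. dc (E t) y)" by (intro intros E)
  have M: "is_linear K (tensor K T C) T M" unfolding M_def by (intro tensor_lift_linear modules bM)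
  have Mp: "M (tensor_pure K T C t y) = dc (E t) y" if "t \<in> carrier T" "y \<in> carrier C" for t y
    unfolding M_def using that by (intro tensor_lift_pure modules bM)
  have Msw: "M (sweedler K C (tensor K T C) (\<lambda>x y. tensor_pure K T C (g (dc d x)) y) c) =
      sweedler K C T (\<lambda>x y. dc (E (g (dc d x))) y) c"
    if g: "is_linear K T T g" and d: "d \<in> carrier D" and c: "c \<in> carrier C" for g d c
  proof -
    have bg: "bilinear K C C (tensor K T C) (\<lambda>x y. tensor_pure K T C (g (dc d x)) y)"
      using d by (intro linear_intros is_linear_compose[OF g] is_linearD(1)[OF g])
    have "M (sweedler K C (tensor K T C) (\<lambda>x y. tensor_pure K T C (g (dc d x)) y) c) =
        sweedler K C T (\<lambda>x y. M (tensor_pure K T C (g (dc d x)) y)) c"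
      by (rule C.linear_sweedler[OF U T bg M c])
    also have "\<dots> = sweedler K C T (\<lambda>x y. dc (E (g (dc d x))) y) c"
      by (rule C.sweedler_cong[OF T bilinear_compose[OF M bg] c])
        (simp add: Mp is_linearD(1)[OF g] modules d)
    finally show ?thesis .
  qed
  have id: "M (right_coaction K C D t) = t" if t: "t \<in> carrier T" for t
  proof (rule tensor_linear_eqI[OF D.module_C C.module_C T
        is_linear_compose[OF M right_coaction_linear] is_linear_id _ t])
    fix d c assume d: "d \<in> carrier D" and c: "c \<in> carrier C"
    have "M (right_coaction K C D (dc d c)) = sweedler K C T (\<lambda>x y. dc (E (dc d x)) y) c"
      unfolding right_coaction_pure[OF d c] by (rule Msw[OF is_linear_id d c])
    also have "\<dots> = sweedler K C T (\<lambda>x y. counit C x \<odot>\<^bsub>T\<^esub> dc d y) c"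
    proof (rule C.sweedler_cong[OF T _ c])
      show "bilinear K C C T (\<lambda>x y. dc (E (dc d x)) y)" using d by (intro intros)
      show "dc (E (dc d x)) y = counit C x \<odot>\<^bsub>T\<^esub> dc d y" if "x \<in> carrier C" "y \<in> carrier C" for x y
        using that d is_linearD(3)[OF bilinearD(1)[OF tensor_pure_bilinear[OF D.module_C C.module_C]]]
        by (simp add: Ep)
    qed
    also have "\<dots> = dc d c"
      using d by (intro C.sweedler_counit_left[OF T _ c] linear_intros)
    finally show "M (right_coaction K C D (dc d c)) = dc d c" .
  qed
  have "f (dc d c) = M (right_coaction K C D (f (dc d c)))"
    by (rule id[symmetric]) (simp add: is_linearD(1)[OF f] modules d c)
  also have "\<dots> = sweedler K C T (\<lambda>x y. dc (E (f (dc d x))) y) c"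
    using colin d c Msw[OF f d c] unfolding right_colinear_iff[OF f] by simp
  finally show ?thesis unfolding E_def .
qed

lemma F_map_linear: "is_linear K T T f \<Longrightarrow> is_linear K S k (F_map K C D f)"
  using F_map_linear_maps by (simp add: linear_maps_def)

text \<open>
  The right expansion writes \<open>f(d \<otimes> c)\<close> as \<open>E' f(d \<otimes> c\<^sub>(\<^sub>1\<^sub>)) \<otimes> c\<^sub>(\<^sub>2\<^sub>)\<close> with \<open>E' = id \<otimes> \<epsilon>\<^sub>C\<close>; the left expansion
  of the inner value turns it into \<open>E' (d\<^sub>(\<^sub>1\<^sub>) \<otimes> E f(d\<^sub>(\<^sub>2\<^sub>) \<otimes> c\<^sub>(\<^sub>1\<^sub>))) \<otimes> c\<^sub>(\<^sub>2\<^sub>)\<close>, where \<open>E'\<close> produces the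
  scalar \<open>\<epsilon>\<^sub>C E f(d\<^sub>(\<^sub>2\<^sub>) \<otimes> c\<^sub>(\<^sub>1\<^sub>)) = F(f)(c\<^sub>(\<^sub>1\<^sub>) \<otimes> d\<^sub>(\<^sub>2\<^sub>))\<close>.
\<close>

lemma twist_F_map_pure:
  assumes f: "is_linear K T T f" and left: "left_colinear K C D f" and right: "right_colinear K C D f"
    and d: "d \<in> carrier D" and c: "c \<in> carrier C"
  shows "f (dc d c) = twist K C D (F_map K C D f) (dc d c)"
proof -
  define E where "E = tensor_lift K D C C (\<lambda>d c. counit D d \<odot>\<^bsub>C\<^esub> c)"
  define E' where "E' = tensor_lift K D C D (\<lambda>d c. counit C c \<odot>\<^bsub>D\<^esub> d)"
  have T: "module K T" and k: "module K k" by (intro modules)+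
  have b: "bilinear K D C C (\<lambda>d c. counit D d \<odot>\<^bsub>C\<^esub> c)" by (intro linear_intros)
  have b': "bilinear K D C D (\<lambda>d c. counit C c \<odot>\<^bsub>D\<^esub> d)" by (intro linear_intros)
  have E: "is_linear K T C E" unfolding E_def by (intro tensor_lift_linear modules b)
  have E': "is_linear K T D E'" unfolding E'_def by (intro tensor_lift_linear modules b')
  have E'p: "E' (dc x y) = counit C y \<odot>\<^bsub>D\<^esub> x" if "x \<in> carrier D" "y \<in> carrier C" for x y
    unfolding E'_def using that by (intro tensor_lift_pure modules b')
  have Ep: "E (dc x y) = counit D x \<odot>\<^bsub>C\<^esub> y" if "x \<in> carrier D" "y \<in> carrier C" for x y
    unfolding E_def using that by (intro tensor_lift_pure modules b)
  have counit_E: "counit C (E t) = counit_tensor K D C t" if t: "t \<in> carrier T" for t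
    by (rule tensor_linear_eqI[OF D.module_C C.module_C k is_linear_compose[OF C.counit_linear E]
          counit_tensor_linear _ t])
      (simp add: Ep counit_tensor_pure is_linearD(3)[OF C.counit_linear])
  note intros = linear_intros is_linear_compose[OF E] is_linearD(1)[OF E]
    is_linear_compose[OF E'] is_linearD(1)[OF E'] is_linear_compose[OF f] is_linearD(1)[OF f]
  have "f (dc d c) = sweedler K C T (\<lambda>x y. dc (E' (f (dc d x))) y) c"
    using right_colinear_expand[OF f right d c] by (simp add: E'_def)
  also have "\<dots> = sweedler K C T (\<lambda>c\<^sub>1 c\<^sub>2. sweedler K D T
      (\<lambda>d\<^sub>1 d\<^sub>2. F_map K C D f (cd c\<^sub>1 d\<^sub>2) \<odot>\<^bsub>T\<^esub> dc d\<^sub>1 c\<^sub>2) d) c"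
  proof (rule C.sweedler_cong[OF T _ c])
    show "bilinear K C C T (\<lambda>x y. dc (E' (f (dc d x))) y)" using d by (intro intros)
    fix c\<^sub>1 c\<^sub>2 assume cc: "c\<^sub>1 \<in> carrier C" "c\<^sub>2 \<in> carrier C"
    have h: "is_linear K T T (\<lambda>t. dc (E' t) c\<^sub>2)" using cc by (intro intros E')
    have b: "bilinear K D D T (\<lambda>x y. dc x (E (f (dc y c\<^sub>1))))" using cc by (intro intros)
    have "dc (E' (f (dc d c\<^sub>1))) c\<^sub>2 =
        dc (E' (sweedler K D T (\<lambda>x y. dc x (E (f (dc y c\<^sub>1)))) d)) c\<^sub>2"
      using left_colinear_expand[OF f left d cc(1)] by (simp add: E_def)
    also have "\<dots> = sweedler K D T (\<lambda>x y. dc (E' (dc x (E (f (dc y c\<^sub>1))))) c\<^sub>2) d"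
      by (rule D.linear_sweedler[OF T T b h d])
    also have "\<dots> = sweedler K D T (\<lambda>d\<^sub>1 d\<^sub>2. F_map K C D f (cd c\<^sub>1 d\<^sub>2) \<odot>\<^bsub>T\<^esub> dc d\<^sub>1 c\<^sub>2) d"
    proof (rule D.sweedler_cong[OF T bilinear_compose[OF h b] d])
      fix x y assume xy: "x \<in> carrier D" "y \<in> carrier D"
      have ft: "f (dc y c\<^sub>1) \<in> carrier T" by (simp add: is_linearD(1)[OF f] modules xy cc)
      show "dc (E' (dc x (E (f (dc y c\<^sub>1))))) c\<^sub>2 = F_map K C D f (cd c\<^sub>1 y) \<odot>\<^bsub>T\<^esub> dc x c\<^sub>2"
        using xy cc ft is_linearD(1)[OF E ft] is_linearD(1)[OF counit_tensor_linear ft]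
          is_linearD(3)[OF bilinearD(1)[OF tensor_pure_bilinear[OF D.module_C C.module_C]]]
        by (simp add: E'p counit_E F_map_pure[OF f])
    qed
    finally show "dc (E' (f (dc d c\<^sub>1))) c\<^sub>2 =
      sweedler K D T (\<lambda>d\<^sub>1 d\<^sub>2. F_map K C D f (cd c\<^sub>1 d\<^sub>2) \<odot>\<^bsub>T\<^esub> dc d\<^sub>1 c\<^sub>2) d" .
  qed
  also have "\<dots> = twist K C D (F_map K C D f) (dc d c)"
    by (rule twist_pure[OF F_map_linear[OF f] d c, symmetric])
  finally show ?thesis .
qed

lemma Tw_simps:
  "f \<in> carrier (Tw K C D) \<longleftrightarrow> f \<in> linear_maps K T T \<and> left_colinear K C D f \<and> right_colinear K C D f"
  "mult (Tw K C D) = compose (carrier T)"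
  "one (Tw K C D) = (\<lambda>t\<in>carrier T. t)"
  "zero (Tw K C D) = (\<lambda>t\<in>carrier T. \<zero>\<^bsub>T\<^esub>)"
  "add (Tw K C D) = (\<lambda>f g. \<lambda>t\<in>carrier T. f t \<oplus>\<^bsub>T\<^esub> g t)"
  "smult (Tw K C D) = (\<lambda>a f. \<lambda>t\<in>carrier T. a \<odot>\<^bsub>T\<^esub> f t)"
  by (simp_all add: Tw_def Let_def)

lemma dual_alg_simps:
  "carrier (dual_alg K C D) = linear_maps K S k"
  "mult (dual_alg K C D) = star K C D"
  "one (dual_alg K C D) = counit_tensor K C D"
  "zero (dual_alg K C D) = (\<lambda>t\<in>carrier S. \<zero>)"
  "add (dual_alg K C D) = (\<lambda>\<phi> \<psi>. \<lambda>t\<in>carrier S. \<phi> t \<oplus> \<psi> t)"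
  "smult (dual_alg K C D) = (\<lambda>a \<phi>. \<lambda>t\<in>carrier S. a \<otimes> \<phi> t)"
  by (simp_all add: dual_alg_def Let_def)

lemma Tw_linear: "f \<in> carrier (Tw K C D) \<Longrightarrow> is_linear K T T f"
  by (simp add: Tw_simps linear_maps_def)

lemma twist_F_map: "f \<in> carrier (Tw K C D) \<Longrightarrow> twist K C D (F_map K C D f) = f"
  using twist_F_map_pure[of f, symmetric] Tw_linear[of f]
  by (intro linear_maps_tensor_eqI[OF D.module_C C.module_C _ twist_linear_maps])
    (simp_all add: Tw_simps modules F_map_linear)

lemma F_map_bij: "bij_betw (F_map K C D) (carrier (Tw K C D)) (carrier (dual_alg K C D))"
proof (rule bij_betw_byWitness[where f' = "twist K C D"])
  show "\<forall>f\<in>carrier (Tw K C D). twist K C D (F_map K C D f) = f" using twist_F_map by blast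
  show "\<forall>\<phi>\<in>carrier (dual_alg K C D). F_map K C D (twist K C D \<phi>) = \<phi>"
  proof
    fix \<phi> assume \<phi>: "\<phi> \<in> carrier (dual_alg K C D)"
    then have lin: "is_linear K S k \<phi>" by (simp add: dual_alg_simps linear_maps_def)
    show "F_map K C D (twist K C D \<phi>) = \<phi>"
      using \<phi> F_map_linear_maps[OF twist_linear[OF lin]] F_map_twist_pure[OF lin]
      by (intro linear_maps_tensor_eqI[OF C.module_C D.module_C, of k])
        (simp_all add: dual_alg_simps modules)
  qed
  show "F_map K C D ` carrier (Tw K C D) \<subseteq> carrier (dual_alg K C D)"
    by (auto simp: dual_alg_simps intro!: F_map_linear_maps Tw_linear)
  show "twist K C D ` carrier (dual_alg K C D) \<subseteq> carrier (Tw K C D)"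
  proof (rule image_subsetI)
    fix \<phi> assume "\<phi> \<in> carrier (dual_alg K C D)"
    then have "is_linear K S k \<phi>" by (simp add: dual_alg_simps linear_maps_def)
    then show "twist K C D \<phi> \<in> carrier (Tw K C D)"
      by (simp add: Tw_simps twist_linear_maps twist_left_colinear twist_right_colinear)
  qed
qed


section \<open>The algebra of colinear maps\<close>

lemma Tw_add_closed:
  assumes f: "f \<in> carrier (Tw K C D)" and g: "g \<in> carrier (Tw K C D)"
  shows "(\<lambda>t\<in>carrier T. f t \<oplus>\<^bsub>T\<^esub> g t) \<in> carrier (Tw K C D)"
proof -
  have T: "module K T" by (intro modules)
  note fl = Tw_linear[OF f] and gl = Tw_linear[OF g]
  have lin: "is_linear K T T (\<lambda>t\<in>carrier T. f t \<oplus>\<^bsub>T\<^esub> g t)"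
    by (rule is_linear_restrict[OF T is_linear_add[OF T fl gl]])
  have "left_colinear K C D (\<lambda>t\<in>carrier T. f t \<oplus>\<^bsub>T\<^esub> g t)"
    unfolding left_colinear_eq
  proof
    fix t assume t: "t \<in> carrier T"
    have cl: "left_coaction K C D t \<in> carrier (tensor K D T)"
      by (rule is_linearD(1)[OF left_coaction_linear t])
    show "left_coaction K C D ((\<lambda>t\<in>carrier T. f t \<oplus>\<^bsub>T\<^esub> g t) t) =
        tensor_map K D T D T (\<lambda>x. x) (\<lambda>t\<in>carrier T. f t \<oplus>\<^bsub>T\<^esub> g t) (left_coaction K C D t)"
      using f g t is_linearD(1)[OF fl t] is_linearD(1)[OF gl t]
      by (simp add: tensor_map_add_right[OF D.module_C T D.module_C T is_linear_id fl gl cl]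
          is_linearD(2)[OF left_coaction_linear] Tw_simps left_colinear_eq)
  qed
  moreover have "right_colinear K C D (\<lambda>t\<in>carrier T. f t \<oplus>\<^bsub>T\<^esub> g t)"
    unfolding right_colinear_eq
  proof
    fix t assume t: "t \<in> carrier T"
    have cl: "right_coaction K C D t \<in> carrier (tensor K T C)"
      by (rule is_linearD(1)[OF right_coaction_linear t])
    show "right_coaction K C D ((\<lambda>t\<in>carrier T. f t \<oplus>\<^bsub>T\<^esub> g t) t) =
        tensor_map K T C T C (\<lambda>t\<in>carrier T. f t \<oplus>\<^bsub>T\<^esub> g t) (\<lambda>x. x) (right_coaction K C D t)"
      using f g t is_linearD(1)[OF fl t] is_linearD(1)[OF gl t]
      by (simp add: tensor_map_add_left[OF T C.module_C T C.module_C fl gl is_linear_id cl]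
          is_linearD(2)[OF right_coaction_linear] Tw_simps right_colinear_eq)
  qed
  ultimately show ?thesis using lin by (simp add: Tw_simps linear_maps_def)
qed

lemma Tw_smult_closed:
  assumes f: "f \<in> carrier (Tw K C D)" and a: "a \<in> carrier K"
  shows "(\<lambda>t\<in>carrier T. a \<odot>\<^bsub>T\<^esub> f t) \<in> carrier (Tw K C D)"
proof -
  have T: "module K T" by (intro modules)
  note fl = Tw_linear[OF f]
  have lin: "is_linear K T T (\<lambda>t\<in>carrier T. a \<odot>\<^bsub>T\<^esub> f t)"
    by (rule is_linear_restrict[OF T is_linear_smult[OF T fl a]])
  have "left_colinear K C D (\<lambda>t\<in>carrier T. a \<odot>\<^bsub>T\<^esub> f t)"
    unfolding left_colinear_eq
  proof
    fix t assume t: "t \<in> carrier T"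
    have cl: "left_coaction K C D t \<in> carrier (tensor K D T)"
      by (rule is_linearD(1)[OF left_coaction_linear t])
    show "left_coaction K C D ((\<lambda>t\<in>carrier T. a \<odot>\<^bsub>T\<^esub> f t) t) =
        tensor_map K D T D T (\<lambda>x. x) (\<lambda>t\<in>carrier T. a \<odot>\<^bsub>T\<^esub> f t) (left_coaction K C D t)"
      using f a t is_linearD(1)[OF fl t]
      by (simp add: tensor_map_smult_right[OF D.module_C T D.module_C T is_linear_id fl a cl]
          is_linearD(3)[OF left_coaction_linear] Tw_simps left_colinear_eq)
  qed
  moreover have "right_colinear K C D (\<lambda>t\<in>carrier T. a \<odot>\<^bsub>T\<^esub> f t)"
    unfolding right_colinear_eq
  proof
    fix t assume t: "t \<in> carrier T"
    have cl: "right_coaction K C D t \<in> carrier (tensor K T C)"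
      by (rule is_linearD(1)[OF right_coaction_linear t])
    show "right_coaction K C D ((\<lambda>t\<in>carrier T. a \<odot>\<^bsub>T\<^esub> f t) t) =
        tensor_map K T C T C (\<lambda>t\<in>carrier T. a \<odot>\<^bsub>T\<^esub> f t) (\<lambda>x. x) (right_coaction K C D t)"
      using f a t is_linearD(1)[OF fl t]
      by (simp add: tensor_map_smult_left[OF T C.module_C T C.module_C fl is_linear_id a cl]
          is_linearD(3)[OF right_coaction_linear] Tw_simps right_colinear_eq)
  qed
  ultimately show ?thesis using lin by (simp add: Tw_simps linear_maps_def)
qed

lemma Tw_id_closed: "(\<lambda>t\<in>carrier T. t) \<in> carrier (Tw K C D)"
proof -
  have T: "module K T" by (intro modules)
  have lin: "is_linear K T T (\<lambda>t\<in>carrier T. t)"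
    by (rule is_linear_restrict[OF T is_linear_id])
  have "left_colinear K C D (\<lambda>t\<in>carrier T. t)" unfolding left_colinear_eq
    using tensor_map_id[OF D.module_C T is_linear_id _ lin]
    by (simp add: is_linearD(1)[OF left_coaction_linear])
  moreover have "right_colinear K C D (\<lambda>t\<in>carrier T. t)" unfolding right_colinear_eq
    using tensor_map_id[OF T C.module_C lin _ is_linear_id]
    by (simp add: is_linearD(1)[OF right_coaction_linear])
  ultimately show ?thesis using lin by (simp add: Tw_simps linear_maps_def)
qed

lemma Tw_compose_closed:
  assumes f: "f \<in> carrier (Tw K C D)" and g: "g \<in> carrier (Tw K C D)"
  shows "compose (carrier T) f g \<in> carrier (Tw K C D)"
proof -
  have T: "module K T" by (intro modules)
  note fl = Tw_linear[OF f] and gl = Tw_linear[OF g]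
  have lin: "is_linear K T T (compose (carrier T) f g)"
    by (rule is_linear_cong[OF T is_linear_compose[OF fl gl]]) (simp add: compose_eq)
  have "left_colinear K C D (compose (carrier T) f g)"
    unfolding left_colinear_eq
  proof
    fix t assume t: "t \<in> carrier T"
    show "left_coaction K C D (compose (carrier T) f g t) =
        tensor_map K D T D T (\<lambda>x. x) (compose (carrier T) f g) (left_coaction K C D t)"
      using f g t is_linearD(1)[OF gl t] is_linearD(1)[OF left_coaction_linear t]
        tensor_map_compose[OF D.module_C T D.module_C T D.module_C T is_linear_id gl is_linear_id fl
          is_linear_id _ lin, of "left_coaction K C D t"]
      by (simp add: compose_eq Tw_simps left_colinear_eq)
  qed
  moreover have "right_colinear K C D (compose (carrier T) f g)"
    unfolding right_colinear_eq
  proof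
    fix t assume t: "t \<in> carrier T"
    show "right_coaction K C D (compose (carrier T) f g t) =
        tensor_map K T C T C (compose (carrier T) f g) (\<lambda>x. x) (right_coaction K C D t)"
      using f g t is_linearD(1)[OF gl t] is_linearD(1)[OF right_coaction_linear t]
        tensor_map_compose[OF T C.module_C T C.module_C T C.module_C gl is_linear_id fl is_linear_id
          lin _ is_linear_id, of "right_coaction K C D t"]
      by (simp add: compose_eq Tw_simps right_colinear_eq)
  qed
  ultimately show ?thesis using lin by (simp add: Tw_simps linear_maps_def compose_def)
qed

lemma assoc_algebra_Tw: "assoc_algebra K (Tw K C D)"
proof -
  interpret T: module K T by (intro modules)
  have ext: "f \<in> extensional (carrier T)" if "f \<in> carrier (Tw K C D)" for f
    using that by (simp add: Tw_simps linear_maps_def)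
  note lin = is_linearD[OF Tw_linear]
  \<comment> \<open>The zero map is the multiple of the identity by \<open>0\<close>.\<close>
  have zero: "(\<lambda>t\<in>carrier T. \<zero>\<^bsub>T\<^esub>) \<in> carrier (Tw K C D)"
  proof -
    have "(\<lambda>t\<in>carrier T. \<zero>\<^bsub>T\<^esub>) = (\<lambda>t\<in>carrier T. \<zero> \<odot>\<^bsub>T\<^esub> (\<lambda>t\<in>carrier T. t) t)"
      by (rule restrict_ext) simp
    then show ?thesis using Tw_smult_closed[OF Tw_id_closed C.R.zero_closed] by simp
  qed
  have mod: "module K (Tw K C D)"
    by (rule module_pointwise[OF T.module_axioms, where S = "carrier T"])
      (simp_all add: Tw_simps(2-) ext lin zero Tw_add_closed Tw_smult_closed)
  then interpret M: module K "Tw K C D" .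
  have ring: "ring (Tw K C D)"
  proof (rule ringI)
    show "abelian_group (Tw K C D)" by (rule M.abelian_group_axioms)
    show "monoid (Tw K C D)"
    proof (rule monoidI, unfold Tw_simps(2-))
      fix f g h
      assume f: "f \<in> carrier (Tw K C D)" and g: "g \<in> carrier (Tw K C D)" and h: "h \<in> carrier (Tw K C D)"
      show "compose (carrier T) (compose (carrier T) f g) h =
          compose (carrier T) f (compose (carrier T) g h)"
        using lin(1)[OF h] by (auto simp: compose_def fun_eq_iff)
    next
      fix f assume f: "f \<in> carrier (Tw K C D)"
      show "compose (carrier T) (\<lambda>t\<in>carrier T. t) f = f" "compose (carrier T) f (\<lambda>t\<in>carrier T. t) = f"
        using lin(1)[OF f] ext[OF f] by (simp_all add: Id_compose[of f _ "carrier T"] compose_Id[of f _ "carrier T"] Pi_iff)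
    qed (simp_all add: Tw_id_closed Tw_compose_closed)
  next
    fix f g h
    assume f: "f \<in> carrier (Tw K C D)" and g: "g \<in> carrier (Tw K C D)" and h: "h \<in> carrier (Tw K C D)"
    show "(f \<oplus>\<^bsub>Tw K C D\<^esub> g) \<otimes>\<^bsub>Tw K C D\<^esub> h =
        f \<otimes>\<^bsub>Tw K C D\<^esub> h \<oplus>\<^bsub>Tw K C D\<^esub> g \<otimes>\<^bsub>Tw K C D\<^esub> h"
      unfolding Tw_simps(2-) by (intro extensionalityI[of _ "carrier T"]) (simp_all add: compose_eq lin[OF h])
    show "h \<otimes>\<^bsub>Tw K C D\<^esub> (f \<oplus>\<^bsub>Tw K C D\<^esub> g) =
        h \<otimes>\<^bsub>Tw K C D\<^esub> f \<oplus>\<^bsub>Tw K C D\<^esub> h \<otimes>\<^bsub>Tw K C D\<^esub> g"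
      unfolding Tw_simps(2-)
      by (intro extensionalityI[of _ "carrier T"]) (simp_all add: compose_eq lin[OF h] lin(1)[OF f] lin(1)[OF g])
  qed
  have "(a \<odot>\<^bsub>Tw K C D\<^esub> f) \<otimes>\<^bsub>Tw K C D\<^esub> g = a \<odot>\<^bsub>Tw K C D\<^esub> (f \<otimes>\<^bsub>Tw K C D\<^esub> g)"
    "f \<otimes>\<^bsub>Tw K C D\<^esub> (a \<odot>\<^bsub>Tw K C D\<^esub> g) = a \<odot>\<^bsub>Tw K C D\<^esub> (f \<otimes>\<^bsub>Tw K C D\<^esub> g)"
    if "a \<in> carrier K" "f \<in> carrier (Tw K C D)" "g \<in> carrier (Tw K C D)" for a f g
    unfolding Tw_simps(2-)
    by (intro extensionalityI[of _ "carrier T"]; simp add: compose_eq lin[OF that(3)] lin(3)[OF that(2)] that(1))+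
  then show ?thesis by (intro assoc_algebra.intro assoc_algebra_axioms.intro mod ring)
qed

section \<open>The isomorphism\<close>

text \<open>
  By \<open>twist_F_map\<close> the inner map \<open>g\<close> may be written as \<open>twist\<close> of \<open>F(g)\<close>; then the linear functional
  \<open>(\<epsilon>\<^sub>D \<otimes> \<epsilon>\<^sub>C) f\<close> is applied under the two sums.
\<close>

lemma F_map_mult:
  assumes f: "f \<in> carrier (Tw K C D)" and g: "g \<in> carrier (Tw K C D)"
  shows "F_map K C D (compose (carrier T) f g) = star K C D (F_map K C D f) (F_map K C D g)"
proof -
  have k: "module K k" and T: "module K T" by (intro modules)+
  note fl = Tw_linear[OF f] and gl = Tw_linear[OF g]
  let ?\<phi> = "F_map K C D f" and ?\<psi> = "F_map K C D g"
  have cl: "?\<phi> (cd c d) \<in> carrier K" "?\<psi> (cd c d) \<in> carrier K" if "c \<in> carrier C" "d \<in> carrier D" for c d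
    using that is_linearD(1)[OF F_map_linear[OF fl]] is_linearD(1)[OF F_map_linear[OF gl]]
    by (simp_all add: modules)
  note intros = linear_intros cl is_linear_compose[OF F_map_linear[OF fl]]
    is_linear_compose[OF F_map_linear[OF gl]]
  have inner: "bilinear K D D k (\<lambda>d\<^sub>1 d\<^sub>2. ?\<phi> (cd c\<^sub>2 d\<^sub>1) \<otimes> ?\<psi> (cd c\<^sub>1 d\<^sub>2))"
    if "c\<^sub>1 \<in> carrier C" "c\<^sub>2 \<in> carrier C" for c\<^sub>1 c\<^sub>2 using that by (intro intros)
  have outer: "bilinear K C C k (\<lambda>c\<^sub>1 c\<^sub>2.
      sweedler K D k (\<lambda>d\<^sub>1 d\<^sub>2. ?\<phi> (cd c\<^sub>2 d\<^sub>1) \<otimes> ?\<psi> (cd c\<^sub>1 d\<^sub>2)) d)"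
    if "d \<in> carrier D" for d using that by (intro intros)
  have b: "bilinear K C D k (\<lambda>c d. sweedler K C k (\<lambda>c\<^sub>1 c\<^sub>2.
      sweedler K D k (\<lambda>d\<^sub>1 d\<^sub>2. ?\<phi> (cd c\<^sub>2 d\<^sub>1) \<otimes> ?\<psi> (cd c\<^sub>1 d\<^sub>2)) d) c)"
    by (intro intros)
  have star: "star K C D ?\<phi> ?\<psi> = tensor_lift K C D k (\<lambda>c d. sweedler K C k (\<lambda>c\<^sub>1 c\<^sub>2.
      sweedler K D k (\<lambda>d\<^sub>1 d\<^sub>2. ?\<phi> (cd c\<^sub>2 d\<^sub>1) \<otimes> ?\<psi> (cd c\<^sub>1 d\<^sub>2)) d) c)"
    by (simp add: star_def sweedler_def)
  show ?thesis
  proof (rule linear_maps_tensor_eqI[OF C.module_C D.module_C k])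
    show "F_map K C D (compose (carrier T) f g) \<in> linear_maps K S k"
      by (intro F_map_linear_maps Tw_linear Tw_compose_closed f g)
    show "star K C D ?\<phi> ?\<psi> \<in> linear_maps K S k"
      unfolding star by (intro tensor_lift_linear_maps modules b)
    fix c d assume c: "c \<in> carrier C" and d: "d \<in> carrier D"
    have h: "is_linear K T k (\<lambda>t. counit_tensor K D C (f t))"
      by (rule is_linear_compose[OF counit_tensor_linear fl])
    have "F_map K C D (compose (carrier T) f g) (cd c d) = counit_tensor K D C (f (g (dc d c)))"
      by (simp add: F_map_pure[OF Tw_linear[OF Tw_compose_closed[OF f g]] c d] compose_eq modules c d)
    also have "\<dots> = counit_tensor K D C (f (twist K C D ?\<psi> (dc d c)))"
      by (simp add: twist_F_map[OF g])
    also have "\<dots> = sweedler K C k (\<lambda>c\<^sub>1 c\<^sub>2. sweedler K D k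
        (\<lambda>d\<^sub>1 d\<^sub>2. ?\<psi> (cd c\<^sub>1 d\<^sub>2) \<odot>\<^bsub>k\<^esub> counit_tensor K D C (f (dc d\<^sub>1 c\<^sub>2))) d) c"
      by (rule linear_twist[OF F_map_linear[OF gl] k h d c])
    also have "\<dots> = sweedler K C k (\<lambda>c\<^sub>1 c\<^sub>2.
        sweedler K D k (\<lambda>d\<^sub>1 d\<^sub>2. ?\<phi> (cd c\<^sub>2 d\<^sub>1) \<otimes> ?\<psi> (cd c\<^sub>1 d\<^sub>2)) d) c"
    proof (rule C.sweedler_cong[OF k outer[OF d] c, symmetric], rule D.sweedler_cong[OF k inner d])
      fix c\<^sub>1 c\<^sub>2 d\<^sub>1 d\<^sub>2
      assume "c\<^sub>1 \<in> carrier C" "c\<^sub>2 \<in> carrier C" "d\<^sub>1 \<in> carrier D" "d\<^sub>2 \<in> carrier D"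
      then show "?\<phi> (cd c\<^sub>2 d\<^sub>1) \<otimes> ?\<psi> (cd c\<^sub>1 d\<^sub>2) =
          ?\<psi> (cd c\<^sub>1 d\<^sub>2) \<odot>\<^bsub>k\<^esub> counit_tensor K D C (f (dc d\<^sub>1 c\<^sub>2))"
        using cl by (simp add: C.m_comm flip: F_map_pure[OF fl])
    qed
    also have "\<dots> = star K C D ?\<phi> ?\<psi> (cd c d)"
      unfolding star by (rule tensor_lift_pure[OF C.module_C D.module_C k b c d, symmetric])
    finally show "F_map K C D (compose (carrier T) f g) (cd c d) = star K C D ?\<phi> ?\<psi> (cd c d)" .
  qed
qed

lemma F_map_apply:
  "F_map K C D f = (\<lambda>s\<in>carrier S. counit_tensor K D C (f (tensor_flip K C D s)))"
  by (rule ext) (simp add: F_map_def compose_def)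

lemma flip_closed: "s \<in> carrier S \<Longrightarrow> tensor_flip K C D s \<in> carrier T"
  by (rule is_linearD(1)[OF tensor_flip_linear[OF C.module_C D.module_C]])

lemma
  assumes f: "f \<in> carrier (Tw K C D)"
  shows F_map_add: "g \<in> carrier (Tw K C D) \<Longrightarrow> F_map K C D (f \<oplus>\<^bsub>Tw K C D\<^esub> g) =
      F_map K C D f \<oplus>\<^bsub>dual_alg K C D\<^esub> F_map K C D g"
    and F_map_smult: "a \<in> carrier K \<Longrightarrow> F_map K C D (a \<odot>\<^bsub>Tw K C D\<^esub> f) =
      a \<odot>\<^bsub>dual_alg K C D\<^esub> F_map K C D f"
  unfolding Tw_simps(2-) dual_alg_simps F_map_apply
  using is_linearD(1)[OF Tw_linear[OF f]] is_linearD(1)[OF Tw_linear[of g]]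
  by (auto intro!: restrict_ext simp: flip_closed is_linearD(2,3)[OF counit_tensor_linear])

lemma F_map_zero: "F_map K C D \<zero>\<^bsub>Tw K C D\<^esub> = \<zero>\<^bsub>dual_alg K C D\<^esub>"
  unfolding Tw_simps(2-) dual_alg_simps F_map_apply
  using is_linear_zero[OF _ _ counit_tensor_linear]
  by (auto intro!: restrict_ext simp: flip_closed modules)

lemma F_map_one: "F_map K C D \<one>\<^bsub>Tw K C D\<^esub> = \<one>\<^bsub>dual_alg K C D\<^esub>"
  unfolding Tw_simps(2-) dual_alg_simps
proof (rule linear_maps_tensor_eqI[OF C.module_C D.module_C])
  show "module K k" by (intro modules)
  have id: "is_linear K T T (\<lambda>t\<in>carrier T. t)" by (rule Tw_linear[OF Tw_id_closed])
  then show "F_map K C D (\<lambda>t\<in>carrier T. t) \<in> linear_maps K S k" by (rule F_map_linear_maps)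
  have b: "bilinear K C D k (\<lambda>c d. counit C c \<otimes> counit D d)" by (intro linear_intros)
  then show "counit_tensor K C D \<in> linear_maps K S k"
    unfolding counit_tensor_def by (intro tensor_lift_linear_maps modules)
  fix c d assume cd: "c \<in> carrier C" "d \<in> carrier D"
  have "counit_tensor K C D (cd c d) = counit C c \<otimes> counit D d"
    unfolding counit_tensor_def by (intro tensor_lift_pure modules b cd)
  then show "F_map K C D (\<lambda>t\<in>carrier T. t) (cd c d) = counit_tensor K C D (cd c d)"
    using cd by (simp add: F_map_pure[OF id] modules counit_tensor_pure C.m_comm)
qed

lemma F_map_ring_hom: "F_map K C D \<in> ring_hom (Tw K C D) (dual_alg K C D)"
  using F_map_bij
  by (intro ring_hom_memI F_map_add F_map_one)
    (auto simp: bij_betw_def F_map_mult Tw_simps(2) dual_alg_simps(2))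

end

theorem theorem4p5:
  fixes K :: "('k, 'r) ring_scheme"
    and C :: "('k, 'c, 'x) coalgebra_scheme"
    and D :: "('k, 'd, 'y) coalgebra_scheme"
  assumes "field K"
    and "coalgebra K C"
    and "coalgebra K D"
  shows "assoc_algebra K (Tw K C D)
    \<and> assoc_algebra K (dual_alg K C D)
    \<and> F_map K C D \<in> algebra_iso K (Tw K C D) (dual_alg K C D)"
proof -
  interpret C: coalgebra K C by fact
  interpret D: coalgebra K D by fact
  interpret coalgebra_pair K C D ..
  have surj: "F_map K C D ` carrier (Tw K C D) = carrier (dual_alg K C D)"
    using F_map_bij by (simp add: bij_betw_def)
  have "assoc_algebra K (dual_alg K C D)"
    by (rule assoc_algebra_image[OF assoc_algebra_Tw F_map_ring_hom surj])
      (rule F_map_zero F_map_smult; assumption?)+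
  moreover have "is_linear K (Tw K C D) (dual_alg K C D) (F_map K C D)"
    by (rule is_linearI) (use surj F_map_add F_map_smult in auto)
  ultimately show ?thesis
    using assoc_algebra_Tw F_map_ring_hom F_map_bij by (simp add: algebra_iso_def ring_iso_def)
qed

end
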